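(* Let $T>0$, $\Omega=(0,+\infty)$, and let $H,F:[0,T]\times\overline\Omega\times\mathbb{R}\to\mathbb{R}$ be functions for which there exists a constant $C>0$ such that the following hold for all $X=(t,x)\in[0,T]\times\overline\Omega$, $s\in[0,T]$ and $p,q\in\mathbb{R}$: (H) $H$ is continuous, $|H(X,0)|\le C$, $|H(X,p)-H(X,q)|\le C|p-q|$; $H(X,p)\to+\infty$ as $|p|\to\infty$ uniformly in $X$; and $|H(s,x,p)-H(t,x,p)|\le C|t-s|\left(1+\max(0,H(t,x,p))\right)$. (F) $F$ is continuous, $|F(X,0)|\le C$, $|F(X,p)-F(X,q)|\le C|p-q|$; $F(X,p)\to+\infty$ as $p\to-\infty$ uniformly in $X$; and $|F(s,x,p)-F(t,x,p)|\le C|t-s|\left(1+\max(0,F(t,x,p),H(t,x,p))\right)$. Let $u_0:\overline\Omega\to\mathbb{R}$ be bounded and Lipschitz continuous. Let $u:[0,T)\times\overline\Omega\to\mathbb{R}$ be a bounded upper semi-continuous viscosity subsolution, and $v:[0,T)\times\overline\Omega\to\mathbb{R}$ a bounded lower semi-continuous viscosity supersolution, of the boundary value problem consisting of the equation $u_t+H(X,u_x)=0$ in $(0,T)\times\Omega$ and the weak boundary condition on $(0,T)\times\partial\Omega$ $$u_t+\min\{F,H\}(X,u_x)\le 0 \ \text{ (for subsolutions)},\qquad u_t+\max\{F,H\}(X,u_x)\ge 0\ \text{ (for supersolutions)}.$$ If $u(0,\cdot)\le u_0\le v(0,\cdot)$ in $\overline\Omega$, then $u\le v$ in $[0,T)\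times\overline\Omega$.
   Context: Here $\overline\Omega=[0,+\infty)$ and $\partial\Omega=\{0\}$. The dependence of $F$ on $x\in\overline\Omega$ is artificial (only $x=0$ matters in the boundary condition). Viscosity subsolution: an upper semi-continuous $u$ such that, whenever a $C^1$ function $\varphi$ on $(0,T)\times\overline\Omega$ (up to the boundary) is such that $u-\varphi$ has a local maximum, relative to $(0,T)\times\overline\Omega$, at $X_0=(t_0,x_0)\in(0,T)\times\overline\Omega$, one has $\varphi_t(X_0)+H(X_0,\varphi_x(X_0))\le 0$ if $x_0>0$, and $\varphi_t(X_0)+\min\{F(X_0,\varphi_x(X_0)),H(X_0,\varphi_x(X_0))\}\le 0$ if $x_0=0$. Viscosity supersolution: a lower semi-continuous $v$ such that, whenever a $C^1$ function $\varphi$ on $(0,T)\times\overline\Omega$ (up to the boundary) is such that $v-\varphi$ has a local minimum, relative to $(0,T)\times\overline\Omega$, at $X_0=(t_0,x_0)\in(0,T)\times\overline\Omega$, one has $\varphi_t(X_0)+H(X_0,\varphi_x(X_0))\ge 0$ if $x_0>0$, and $\varphi_t(X_0)+\max\{F(X_0,\varphi_x(X_0)),H(X_0,\varphi_x(X_0))\}\ge 0$ if $x_0=0$. *)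

theory Defs
  imports "HOL-Analysis.Analysis"
begin

text \<open>Points are pairs \<open>X = (t, x)\<close>. Here \<open>\<Omega> = (0, \<infinity>)\<close>, so its closure is \<open>{0..}\<close> and its
  boundary is \<open>x = 0\<close>.\<close>

abbreviation data_domain :: "real \<Rightarrow> (real \<times> real) set" where
  "data_domain T \<equiv> {0..T} \<times> {0..}"

abbreviation solution_domain :: "real \<Rightarrow> (real \<times> real) set" where
  "solution_domain T \<equiv> {0..<T} \<times> {0..}"

abbreviation test_domain :: "real \<Rightarrow> (real \<times> real) set" where
  "test_domain T \<equiv> {0<..<T} \<times> {0..}"

text \<open>Structural assumptions on the Hamiltonian. The filter \<open>at_infinity\<close> on the reals is
  \<open>\<bar>p\<bar> \<rightarrow> \<infinity>\<close>; the quantifier over \<open>X\<close> under \<open>eventually\<close> expresses that the limit is uniform.\<close>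

definition hamiltonian_cond ::
    "real \<Rightarrow> real \<Rightarrow> (real \<times> real \<Rightarrow> real \<Rightarrow> real) \<Rightarrow> bool" where
  "hamiltonian_cond T C H \<longleftrightarrow>
     continuous_on (data_domain T \<times> UNIV) (\<lambda>(X, p). H X p) \<and>
     (\<forall>X\<in>data_domain T. \<bar>H X 0\<bar> \<le> C) \<and>
     (\<forall>X\<in>data_domain T. \<forall>p q. \<bar>H X p - H X q\<bar> \<le> C * \<bar>p - q\<bar>) \<and>
     (\<forall>M. \<forall>\<^sub>F p in at_infinity. \<forall>X\<in>data_domain T. M \<le> H X p) \<and>
     (\<forall>s\<in>{0..T}. \<forall>t\<in>{0..T}. \<forall>x\<ge>0. \<forall>p.
        \<bar>H (s, x) p - H (t, x) p\<bar> \<le> C * \<bar>t - s\<bar> * (1 + max 0 (H (t, x) p)))"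

definition boundary_cond ::
    "real \<Rightarrow> real \<Rightarrow> (real \<times> real \<Rightarrow> real \<Rightarrow> real) \<Rightarrow> (real \<times> real \<Rightarrow> real \<Rightarrow> real) \<Rightarrow> bool" where
  "boundary_cond T C H F \<longleftrightarrow>
     continuous_on (data_domain T \<times> UNIV) (\<lambda>(X, p). F X p) \<and>
     (\<forall>X\<in>data_domain T. \<bar>F X 0\<bar> \<le> C) \<and>
     (\<forall>X\<in>data_domain T. \<forall>p q. \<bar>F X p - F X q\<bar> \<le> C * \<bar>p - q\<bar>) \<and>
     (\<forall>M. \<forall>\<^sub>F p in at_bot. \<forall>X\<in>data_domain T. M \<le> F X p) \<and>
     (\<forall>s\<in>{0..T}. \<forall>t\<in>{0..T}. \<forall>x\<ge>0. \<forall>p.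
        \<bar>F (s, x) p - F (t, x) p\<bar>
          \<le> C * \<bar>t - s\<bar> * (1 + max 0 (max (F (t, x) p) (H (t, x) p))))"

definition upper_semicontinuous_on :: "'a::topological_space set \<Rightarrow> ('a \<Rightarrow> real) \<Rightarrow> bool" where
  "upper_semicontinuous_on S f \<longleftrightarrow> (\<forall>x\<in>S. \<forall>c>f x. \<forall>\<^sub>F y in at x within S. f y < c)"

definition lower_semicontinuous_on :: "'a::topological_space set \<Rightarrow> ('a \<Rightarrow> real) \<Rightarrow> bool" where
  "lower_semicontinuous_on S f \<longleftrightarrow> (\<forall>x\<in>S. \<forall>c<f x. \<forall>\<^sub>F y in at x within S. c < f y)"

definition local_max_within :: "'a::topological_space set \<Rightarrow> ('a \<Rightarrow> real) \<Rightarrow> 'a \<Rightarrow> bool" where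
  "local_max_within S f x \<longleftrightarrow> (\<forall>\<^sub>F y in at x within S. f y \<le> f x)"

definition local_min_within :: "'a::topological_space set \<Rightarrow> ('a \<Rightarrow> real) \<Rightarrow> 'a \<Rightarrow> bool" where
  "local_min_within S f x \<longleftrightarrow> (\<forall>\<^sub>F y in at x within S. f x \<le> f y)"

text \<open>\<open>C1_with_partials S \<phi> \<phi>\<^sub>t \<phi>\<^sub>x\<close>: \<open>\<phi>\<close> is continuously differentiable on \<open>S\<close> with partial
  derivatives \<open>\<phi>\<^sub>t\<close>, \<open>\<phi>\<^sub>x\<close>. On \<open>test_domain T\<close> this means \<open>C\<^sup>1\<close> up to the boundary: derivatives are
  taken within the domain, so that \<open>\<phi>\<^sub>x\<close> is the right derivative at \<open>x = 0\<close>, and they determine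
  \<open>\<phi>\<^sub>t\<close> and \<open>\<phi>\<^sub>x\<close> uniquely there.\<close>

definition C1_with_partials ::
    "(real \<times> real) set \<Rightarrow> (real \<times> real \<Rightarrow> real) \<Rightarrow> (real \<times> real \<Rightarrow> real) \<Rightarrow>
     (real \<times> real \<Rightarrow> real) \<Rightarrow> bool" where
  "C1_with_partials S \<phi> \<phi>\<^sub>t \<phi>\<^sub>x \<longleftrightarrow>
     continuous_on S \<phi>\<^sub>t \<and> continuous_on S \<phi>\<^sub>x \<and>
     (\<forall>X\<in>S. (\<phi> has_derivative (\<lambda>h. \<phi>\<^sub>t X * fst h + \<phi>\<^sub>x X * snd h)) (at X within S))"

text \<open>Semicontinuity is required on the whole set where the functions live, including \<open>t = 0\<close>;
  otherwise the comparison with the initial datum would say nothing about positive times.\<close>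

definition viscosity_subsolution ::
    "real \<Rightarrow> (real \<times> real \<Rightarrow> real \<Rightarrow> real) \<Rightarrow> (real \<times> real \<Rightarrow> real \<Rightarrow> real) \<Rightarrow>
     (real \<times> real \<Rightarrow> real) \<Rightarrow> bool" where
  "viscosity_subsolution T H F u \<longleftrightarrow>
     upper_semicontinuous_on (solution_domain T) u \<and>
     (\<forall>\<phi> \<phi>\<^sub>t \<phi>\<^sub>x. C1_with_partials (test_domain T) \<phi> \<phi>\<^sub>t \<phi>\<^sub>x \<longrightarrow>
       (\<forall>X\<in>test_domain T. local_max_within (test_domain T) (\<lambda>Y. u Y - \<phi> Y) X \<longrightarrow>
         (snd X > 0 \<longrightarrow> \<phi>\<^sub>t X + H X (\<phi>\<^sub>x X) \<le> 0) \<and>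
         (snd X = 0 \<longrightarrow> \<phi>\<^sub>t X + min (F X (\<phi>\<^sub>x X)) (H X (\<phi>\<^sub>x X)) \<le> 0)))"

definition viscosity_supersolution ::
    "real \<Rightarrow> (real \<times> real \<Rightarrow> real \<Rightarrow> real) \<Rightarrow> (real \<times> real \<Rightarrow> real \<Rightarrow> real) \<Rightarrow>
     (real \<times> real \<Rightarrow> real) \<Rightarrow> bool" where
  "viscosity_supersolution T H F v \<longleftrightarrow>
     lower_semicontinuous_on (solution_domain T) v \<and>
     (\<forall>\<phi> \<phi>\<^sub>t \<phi>\<^sub>x. C1_with_partials (test_domain T) \<phi> \<phi>\<^sub>t \<phi>\<^sub>x \<longrightarrow>
       (\<forall>X\<in>test_domain T. local_min_within (test_domain T) (\<lambda>Y. v Y - \<phi> Y) X \<longrightarrow>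
         (snd X > 0 \<longrightarrow> \<phi>\<^sub>t X + H X (\<phi>\<^sub>x X) \<ge> 0) \<and>
         (snd X = 0 \<longrightarrow> \<phi>\<^sub>t X + max (F X (\<phi>\<^sub>x X)) (H X (\<phi>\<^sub>x X)) \<ge> 0)))"

end

theory Submission
  imports Defs
begin

text \<open>Penalising \<open>u - v\<close> makes \<open>u\<close> a strict subsolution with margin \<open>e\<close>. Variables are doubled
  in time only, and \<open>v\<close> enters as the subsolution \<open>- v\<close> for \<open>- H(X, - p)\<close>.
  At a positive maximum \<open>(t0, s0, x0)\<close> of \<open>u(t,x) - v(s,x) - j (t - s)\<^sup>2\<close> with \<open>j\<close> large,
  put \<open>a = 2 j (t0 - s0)\<close>. The time regularity of \<open>H\<close> and \<open>F\<close> then shows that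
  \<open>H(t0,x0,p) \<le> - a - e\<close> forces \<open>H(s0,x0,p) < - a\<close>, and similarly for \<open>F\<close> if both are small.
  If \<open>x0 > 0\<close>, doubling \<open>x\<close> as well gives a contradiction.

  If \<open>x0 = 0\<close>, let \<open>P\<close> be the set of slopes \<open>p\<close> for which, near the boundary, \<open>u\<close> lies below its
  quadratic expansion in time plus \<open>p x\<close>, and let \<open>Q\<close> be the set of slopes for which \<open>v\<close> lies above.
  The boundary conditions hold at slopes in \<open>P\<close> and \<open>Q\<close> respectively. Critical slopes carry interior
  information: \<open>H \<le> - a - e\<close> at \<open>inf P\<close>, \<open>H \<ge> - a\<close> at \<open>sup Q\<close> (or at large slopes, by coercivity,
  if \<open>sup Q\<close> is infinite), and both would hold at a slope outside
  \<open>P \<union> Q\<close>, so \<open>P \<union> Q\<close> is everything and \<open>inf P \<le> sup Q\<close>. Between these two values each slope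
  satisfies exactly one of \<open>H(t0,0,p) \<le> - a - e\<close> and \<open>F(t0,0,p) \<le> - a - e\<close>. Both conditions are
  closed and the first holds only at one end, which contradicts connectedness.\<close>

section \<open>Upper semicontinuous functions\<close>

text \<open>Since \<open>c\<close> exceeds \<open>f x\<close>, adding the point itself to a
  punctured neighbourhood changes nothing. The unpunctured form suits compositions, where
  \<open>h\<close> may send nearby points to \<open>h x\<close>.\<close>

lemma upper_semicontinuous_on_iff_nhds:
  "upper_semicontinuous_on S f \<longleftrightarrow>
     (\<forall>x\<in>S. \<forall>c>f x. \<forall>\<^sub>F y in nhds x. y \<in> S \<longrightarrow> f y < c)"
proof -
  have "(\<forall>\<^sub>F y in at x within S. f y < c) \<longleftrightarrow> (\<forall>\<^sub>F y in nhds x. y \<in> S \<longrightarrow> f y < c)"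
    if "f x < c" for x c
    unfolding eventually_at_filter
    by (rule iffI; erule eventually_mono) (use that in auto)
  then show ?thesis
    unfolding upper_semicontinuous_on_def by auto
qed

lemma upper_semicontinuous_on_compose:
  assumes "upper_semicontinuous_on S f" "continuous_on A h" "h ` A \<subseteq> S"
  shows "upper_semicontinuous_on A (\<lambda>y. f (h y))"
  unfolding upper_semicontinuous_on_def
proof (intro ballI allI impI)
  fix x c assume x: "x \<in> A" and c: "f (h x) < c"
  have "\<forall>\<^sub>F y in nhds (h x). y \<in> S \<longrightarrow> f y < c"
    using assms(1,3) x c unfolding upper_semicontinuous_on_iff_nhds by blast
  moreover have "(h \<longlongrightarrow> h x) (at x within A)"
    using assms(2) x by (simp add: continuous_on)
  ultimately have "\<forall>\<^sub>F y in at x within A. h y \<in> S \<longrightarrow> f (h y) < c"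
    unfolding filterlim_iff by blast
  moreover have "\<forall>\<^sub>F y in at x within A. y \<in> A"
    by (simp add: eventually_at_filter)
  ultimately show "\<forall>\<^sub>F y in at x within A. f (h y) < c"
    by eventually_elim (use assms(3) in auto)
qed

lemma upper_semicontinuous_on_subset:
  assumes "upper_semicontinuous_on S f" "A \<subseteq> S"
  shows "upper_semicontinuous_on A f"
  using upper_semicontinuous_on_compose[OF assms(1) continuous_on_id[of A]] assms(2) by simp

lemma upper_semicontinuous_on_add:
  fixes f g :: "'a::topological_space \<Rightarrow> real"
  assumes "upper_semicontinuous_on S f" "upper_semicontinuous_on S g"
  shows "upper_semicontinuous_on S (\<lambda>x. f x + g x)"
  unfolding upper_semicontinuous_on_def
proof (intro ballI allI impI)
  fix x c assume x: "x \<in> S" and c: "f x + g x < c"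
  define e where "e = (c - f x - g x) / 2"
  have "e > 0" using c by (simp add: e_def)
  then have "\<forall>\<^sub>F y in at x within S. f y < f x + e" "\<forall>\<^sub>F y in at x within S. g y < g x + e"
    using assms x unfolding upper_semicontinuous_on_def by simp_all
  then show "\<forall>\<^sub>F y in at x within S. f y + g y < c"
    by eventually_elim (simp add: e_def field_simps)
qed

lemma continuous_on_imp_upper_semicontinuous_on:
  assumes "continuous_on S f"
  shows "upper_semicontinuous_on S f"
  using assms unfolding upper_semicontinuous_on_def continuous_on
  by (auto simp: order_tendsto_iff)

lemma upper_semicontinuous_on_diff_continuous:
  fixes f g :: "'a::topological_space \<Rightarrow> real"
  assumes "upper_semicontinuous_on S f" "continuous_on S g"
  shows "upper_semicontinuous_on S (\<lambda>x. f x - g x)"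
proof -
  have "upper_semicontinuous_on S (\<lambda>x. - g x)"
    using assms(2) by (intro continuous_on_imp_upper_semicontinuous_on continuous_intros)
  from upper_semicontinuous_on_add[OF assms(1) this] show ?thesis by simp
qed

text \<open>If no point were a maximizer, each \<open>x\<close> would have a better competitor
  \<open>Y x\<close> and a neighbourhood on which \<open>f\<close> stays below
  \<open>f (Y x)\<close>. The best competitor of a finite subcover lies in one of its sets, hence is
  beaten by another competitor.\<close>

lemma upper_semicontinuous_on_attains_sup:
  assumes "compact K" "K \<noteq> {}" "upper_semicontinuous_on K f"
  shows "\<exists>x\<in>K. \<forall>y\<in>K. f y \<le> f x"
proof (rule ccontr)
  assume "\<not> ?thesis"
  then have "\<forall>x\<in>K. \<exists>y\<in>K. f x < f y" by (meson not_le)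
  then obtain Y where Y: "\<And>x. x \<in> K \<Longrightarrow> Y x \<in> K" "\<And>x. x \<in> K \<Longrightarrow> f x < f (Y x)"
    by metis
  have "\<exists>U. open U \<and> x \<in> U \<and> (\<forall>y\<in>U. y \<in> K \<longrightarrow> f y < f (Y x))" if "x \<in> K" for x
    using assms(3) that Y(2)[OF that]
    unfolding upper_semicontinuous_on_iff_nhds eventually_nhds by blast
  then obtain U where U: "\<And>x. x \<in> K \<Longrightarrow> open (U x)" "\<And>x. x \<in> K \<Longrightarrow> x \<in> U x"
    "\<And>x y. x \<in> K \<Longrightarrow> y \<in> U x \<Longrightarrow> y \<in> K \<Longrightarrow> f y < f (Y x)" by metis
  have "K \<subseteq> \<Union>(U ` K)" using U(2) by blast
  with compactE_image[OF assms(1), of K U] U(1)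
  obtain C where C: "C \<subseteq> K" "finite C" "K \<subseteq> \<Union>(U ` C)" by metis
  then have ne: "C \<noteq> {}" using assms(2) by auto
  define m where "m = Max ((\<lambda>x. f (Y x)) ` C)"
  have "m \<in> (\<lambda>x. f (Y x)) ` C" unfolding m_def using C(2) ne by simp
  then obtain x where x: "x \<in> C" "m = f (Y x)" by blast
  then obtain x' where x': "x' \<in> C" "Y x \<in> U x'" using C Y(1) by blast
  then have "m < f (Y x')" using U(3) C(1) Y(1) x by blast
  moreover have "f (Y x') \<le> m" unfolding m_def using C(2) x'(1) by simp
  ultimately show False by simp
qed

section \<open>Limits of maximizers under growing penalties\<close>

lemma upper_semicontinuous_on_ge_limit:
  assumes "upper_semicontinuous_on S f" "\<And>n. X n \<in> S" "X \<longlonglongrightarrow> x" "x \<in> S"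
    and "\<And>n. c \<le> f (X n)"
  shows "c \<le> f x"
proof (rule ccontr)
  assume "\<not> c \<le> f x"
  then have "\<forall>\<^sub>F y in nhds x. y \<in> S \<longrightarrow> f y < c"
    using assms(1,4) unfolding upper_semicontinuous_on_iff_nhds by simp
  then have "\<forall>\<^sub>F n in sequentially. X n \<in> S \<longrightarrow> f (X n) < c"
    using assms(3) unfolding filterlim_iff by blast
  then obtain n where "X n \<in> S \<longrightarrow> f (X n) < c"
    using eventually_happens'[OF sequentially_bot] by blast
  then show False
    using assms(2,5)[of n] by simp
qed

text \<open>The abstract core of doubling variables. Comparing \<open>z n\<close> with a zero
  \<open>y\<close> of \<open>g\<close> gives \<open>n * g (z n) \<le> f (z n) - f y\<close>; as
  \<open>f\<close> is bounded above on \<open>K\<close>, \<open>g (z n)\<close> tends to 0 along the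
  subsequence, so the limit \<open>l\<close> is itself a zero of \<open>g\<close>.\<close>

lemma penalized_maximizers_converge:
  fixes f g :: "'a::metric_space \<Rightarrow> real"
  assumes K: "compact K" and f: "upper_semicontinuous_on K f"
    and g: "continuous_on K g" "\<And>y. y \<in> K \<Longrightarrow> 0 \<le> g y"
    and y0: "y0 \<in> K" "g y0 = 0"
    and z: "\<And>n. z n \<in> K" "\<And>n y. y \<in> K \<Longrightarrow> f y - real n * g y \<le> f (z n) - real n * g (z n)"
  obtains r l where "strict_mono r" "l \<in> K" "(z \<circ> r) \<longlonglongrightarrow> l" "g l = 0"
    "(\<lambda>n. real (r n) * g (z (r n))) \<longlonglongrightarrow> 0" "\<And>y. y \<in> K \<Longrightarrow> g y = 0 \<Longrightarrow> f y \<le> f l"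
proof -
  obtain r l where r: "l \<in> K" "strict_mono r" "(z \<circ> r) \<longlonglongrightarrow> l"
    using K z(1) unfolding compact_def by metis
  obtain ym where ym: "ym \<in> K" "\<And>y. y \<in> K \<Longrightarrow> f y \<le> f ym"
    using upper_semicontinuous_on_attains_sup[OF K _ f] y0 by blast
  have below: "real n * g (z n) \<le> f (z n) - f y" if "y \<in> K" "g y = 0" for n y
    using z(2)[OF that(1), of n] that(2) by simp
  have gl: "(\<lambda>n. g (z (r n))) \<longlonglongrightarrow> g l"
    using continuous_on_tendsto_compose[OF g(1) r(3,1)] z(1) by (simp add: comp_def)
  have "(\<lambda>n. g (z (r n))) \<longlonglongrightarrow> 0"
  proof (rule tendsto_sandwich[of "\<lambda>n. 0" _ _ "\<lambda>n. (f ym - f y0) / real (r n)"])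
    show "\<forall>\<^sub>F n in sequentially. g (z (r n)) \<le> (f ym - f y0) / real (r n)"
    proof (rule eventually_sequentiallyI[of 1])
      fix n :: nat assume "1 \<le> n"
      then have "real (r n) > 0"
        using seq_suble[OF r(2), of n] by simp
      then show "g (z (r n)) \<le> (f ym - f y0) / real (r n)"
        using below[OF y0, of "r n"] ym(2)[OF z(1)[of "r n"]] by (simp add: field_simps)
    qed
    have "filterlim (\<lambda>n. real (r n)) at_top sequentially"
      using filterlim_compose[OF filterlim_real_sequentially filterlim_subseq[OF r(2)]] .
    then show "(\<lambda>n. (f ym - f y0) / real (r n)) \<longlonglongrightarrow> 0"
      by (rule real_tendsto_divide_at_top[OF tendsto_const])
  qed (use g(2) z(1) in auto)
  then have l0: "g l = 0" using gl LIMSEQ_unique by blast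
  have max: "f y \<le> f l" if "y \<in> K" "g y = 0" for y
  proof (rule upper_semicontinuous_on_ge_limit[OF f _ r(3) r(1)])
    fix n
    have "0 \<le> real (r n) * g (z (r n))" using g(2) z(1) by simp
    then show "f y \<le> f ((z \<circ> r) n)" using below[OF that, of "r n"] by simp
  qed (use z(1) in simp)
  have "(\<lambda>n. real (r n) * g (z (r n))) \<longlonglongrightarrow> 0"
  proof (rule order_tendstoI)
    fix a :: real assume "a < 0"
    moreover have "0 \<le> real (r n) * g (z (r n))" for n using g(2) z(1) by simp
    ultimately show "\<forall>\<^sub>F n in sequentially. a < real (r n) * g (z (r n))"
      by (intro always_eventually allI) (meson less_le_trans)
  next
    \<comment> \<open>The comparison point is now \<open>l\<close> itself:
      \<open>f (z (r n)) - f l\<close> bounds the penalty and is eventually below \<open>a\<close>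
      by upper semicontinuity.\<close>
    fix a :: real assume "0 < a"
    then have "\<forall>\<^sub>F y in nhds l. y \<in> K \<longrightarrow> f y < f l + a"
      using f r(1) unfolding upper_semicontinuous_on_iff_nhds by simp
    then have "\<forall>\<^sub>F n in sequentially. (z \<circ> r) n \<in> K \<longrightarrow> f ((z \<circ> r) n) < f l + a"
      using r(3) unfolding filterlim_iff by blast
    then show "\<forall>\<^sub>F n in sequentially. real (r n) * g (z (r n)) < a"
    proof eventually_elim
      case (elim n)
      then show ?case using below[OF r(1) l0, of "r n"] z(1)[of "r n"] by simp
    qed
  qed
  then show thesis using that r l0 max by blast
qed

section \<open>Quadratic test functions\<close>

text \<open>Test functions that are separate quadratics in \<open>t\<close> and \<open>x\<close>
  suffice for the whole proof. \<open>S\<close> selects the interior equation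
  (\<open>{0<..}\<close>) or the boundary condition (\<open>{0}\<close>), with \<open>K\<close> the
  operator in force there. The box of half-width \<open>d\<close> is not cut at times 0 and
  \<open>T\<close>; this is harmless because \<open>d\<close> may be chosen small.\<close>

definition quadratic_subsolution ::
    "real \<Rightarrow> real set \<Rightarrow> (real \<times> real \<Rightarrow> real \<Rightarrow> real) \<Rightarrow> (real \<times> real \<Rightarrow> real) \<Rightarrow> bool" where
  "quadratic_subsolution T S K z \<longleftrightarrow>
     (\<forall>a k m c t x d. 0 < t \<longrightarrow> t < T \<longrightarrow> x \<in> S \<longrightarrow> 0 < d \<longrightarrow>
       (\<forall>t' x'. \<bar>t' - t\<bar> < d \<longrightarrow> \<bar>x' - x\<bar> < d \<longrightarrow> 0 \<le> x' \<longrightarrow>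
          z (t', x') - (a * t' + k * t'\<^sup>2 + m * x' + c * x'\<^sup>2)
            \<le> z (t, x) - (a * t + k * t\<^sup>2 + m * x + c * x\<^sup>2)) \<longrightarrow>
       a + 2 * k * t + K (t, x) (m + 2 * c * x) \<le> 0)"

lemma quadratic_subsolutionD:
  assumes "quadratic_subsolution T S K z" "0 < t" "t < T" "x \<in> S" "0 < d"
    and "\<And>t' x'. \<bar>t' - t\<bar> < d \<Longrightarrow> \<bar>x' - x\<bar> < d \<Longrightarrow> 0 \<le> x' \<Longrightarrow>
          z (t', x') - (a * t' + k * t'\<^sup>2 + m * x' + c * x'\<^sup>2)
            \<le> z (t, x) - (a * t + k * t\<^sup>2 + m * x + c * x\<^sup>2)"
  shows "a + 2 * k * t + K (t, x) (m + 2 * c * x) \<le> 0"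
  using assms unfolding quadratic_subsolution_def by blast

text \<open>Moving the penalty into the test function adds \<open>\<eta> / (T - t)\<^sup>2\<close>,
  at least \<open>\<eta> / T\<^sup>2\<close>, to its time derivative and \<open>\<alpha>\<close> to
  its slope. The first is a gain, the second costs at most \<open>C * \<alpha>\<close> by the
  Lipschitz bound; the difference is the strict margin.\<close>

lemma perturbed_quadratic_subsolution:
  assumes T: "0 < T" and nonneg: "0 \<le> \<eta>" and S: "S \<subseteq> {0..}"
    and test: "\<And>\<phi> \<phi>t \<phi>x X. C1_with_partials (test_domain T) \<phi> \<phi>t \<phi>x \<Longrightarrow> X \<in> test_domain T \<Longrightarrow>
      snd X \<in> S \<Longrightarrow> local_max_within (test_domain T) (\<lambda>Y. z Y - \<phi> Y) X \<Longrightarrow>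
      \<phi>t X + K X (\<phi>x X) \<le> 0"
    and lip: "\<And>X p. X \<in> data_domain T \<Longrightarrow> \<bar>K X (p + \<alpha>) - K X p\<bar> \<le> C * \<alpha>"
  shows "quadratic_subsolution T S (\<lambda>X p. K X p + (\<eta> / T\<^sup>2 - C * \<alpha>))
    (\<lambda>X. z X - \<eta> / (T - fst X) - \<alpha> * snd X)"
  unfolding quadratic_subsolution_def
proof (intro allI impI)
  fix a k m c t x d :: real
  assume t: "0 < t" "t < T" and x: "x \<in> S" and d: "0 < d"
    and max: "\<forall>t' x'. \<bar>t' - t\<bar> < d \<longrightarrow> \<bar>x' - x\<bar> < d \<longrightarrow> 0 \<le> x' \<longrightarrow>
      z (t', x') - \<eta> / (T - fst (t', x')) - \<alpha> * snd (t', x')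
        - (a * t' + k * t'\<^sup>2 + m * x' + c * x'\<^sup>2)
      \<le> z (t, x) - \<eta> / (T - fst (t, x)) - \<alpha> * snd (t, x)
        - (a * t + k * t\<^sup>2 + m * x + c * x\<^sup>2)"
  define \<phi> where "\<phi> = (\<lambda>X. a * fst X + k * (fst X)\<^sup>2 + \<eta> / (T - fst X) + (m + \<alpha>) * snd X
    + c * (snd X)\<^sup>2 :: real)"
  define \<phi>t where "\<phi>t = (\<lambda>X::real \<times> real. a + 2 * k * fst X + \<eta> / (T - fst X)\<^sup>2)"
  define \<phi>x where "\<phi>x = (\<lambda>X::real \<times> real. m + \<alpha> + 2 * c * snd X)"
  have "C1_with_partials (test_domain T) \<phi> \<phi>t \<phi>x"
    unfolding C1_with_partials_def
  proof (intro conjI ballI)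
    show "continuous_on (test_domain T) \<phi>t" "continuous_on (test_domain T) \<phi>x"
      unfolding \<phi>t_def \<phi>x_def by (auto intro!: continuous_intros)
    fix X assume "X \<in> test_domain T"
    then have "T - fst X \<noteq> 0" by auto
    then show "(\<phi> has_derivative (\<lambda>h. \<phi>t X * fst h + \<phi>x X * snd h)) (at X within test_domain T)"
      unfolding \<phi>_def \<phi>t_def \<phi>x_def
      by (auto intro!: derivative_eq_intros simp: fun_eq_iff field_simps power2_eq_square)
  qed
  moreover have X: "(t, x) \<in> test_domain T" using t x S by auto
  moreover have "local_max_within (test_domain T) (\<lambda>Y. z Y - \<phi> Y) (t, x)"
    unfolding local_max_within_def eventually_at
  proof (intro exI[of _ d] conjI d ballI impI)
    fix Y assume Y: "Y \<in> test_domain T" "Y \<noteq> (t, x) \<and> dist Y (t, x) < d"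
    have "dist (fst Y) t < d" "dist (snd Y) x < d"
      using Y(2) dist_fst_le[of Y "(t, x)"] dist_snd_le[of Y "(t, x)"] by auto
    then show "z Y - \<phi> Y \<le> z (t, x) - \<phi> (t, x)"
      using max[rule_format, of "fst Y" "snd Y"] Y(1)
      by (auto simp: dist_real_def \<phi>_def algebra_simps)
  qed
  ultimately have "\<phi>t (t, x) + K (t, x) (\<phi>x (t, x)) \<le> 0" using test x by simp
  then have le: "a + 2 * k * t + \<eta> / (T - t)\<^sup>2 + K (t, x) (m + 2 * c * x + \<alpha>) \<le> 0"
    by (simp add: \<phi>t_def \<phi>x_def algebra_simps)
  have "(T - t)\<^sup>2 \<le> T\<^sup>2" using t by (intro power_mono) auto
  then have "\<eta> / T\<^sup>2 \<le> \<eta> / (T - t)\<^sup>2" using t nonneg by (intro divide_left_mono) auto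
  moreover have "K (t, x) (m + 2 * c * x) - C * \<alpha> \<le> K (t, x) (m + 2 * c * x + \<alpha>)"
    using lip[of "(t, x)" "m + 2 * c * x"] t X by auto
  ultimately show "a + 2 * k * t + (K (t, x) (m + 2 * c * x) + (\<eta> / T\<^sup>2 - C * \<alpha>)) \<le> 0"
    using le by linarith
qed

section \<open>Maxima in the interior\<close>

text \<open>Doubling \<open>x\<close> with penalty \<open>n * (x - y)\<^sup>2\<close> makes the
  slopes tested on \<open>w1\<close> and \<open>w2\<close> opposite up to a vanishing error.
  Coercivity of \<open>K1\<close> alone bounds them, so a subsequence converges to one slope
  \<open>p\<close> that serves both inequalities.\<close>

lemma interior_doubling:
  fixes w1 w2 :: "real \<times> real \<Rightarrow> real"
  assumes usc: "upper_semicontinuous_on (solution_domain T) w1"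
      "upper_semicontinuous_on (solution_domain T) w2"
    and sub: "quadratic_subsolution T {0<..} K1 w1" "quadratic_subsolution T {0<..} K2 w2"
    and cont: "continuous_on (data_domain T \<times> UNIV) (\<lambda>(X, p). K1 X p)"
      "continuous_on (data_domain T \<times> UNIV) (\<lambda>(X, p). K2 X p)"
    and coercive: "\<And>M. \<exists>L. \<forall>X\<in>data_domain T. \<forall>p. K1 X p \<le> M \<longrightarrow> \<bar>p\<bar> \<le> L"
    and t0: "0 < t0" "t0 < T" and s0: "0 < s0" "s0 < T" and x0: "0 < x0" and j: "0 \<le> j"
    and max: "\<And>t s x. 0 \<le> t \<Longrightarrow> t < T \<Longrightarrow> 0 \<le> s \<Longrightarrow> s < T \<Longrightarrow> 0 \<le> x \<Longrightarrow>
      w1 (t, x) + w2 (s, x) - j * (t - s)\<^sup>2 \<le> w1 (t0, x0) + w2 (s0, x0) - j * (t0 - s0)\<^sup>2"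
  obtains p where "2 * j * (t0 - s0) + K1 (t0, x0) p \<le> 0"
    "- (2 * j * (t0 - s0)) + K2 (s0, x0) (- p) \<le> 0"
proof -
  \<comment> \<open>Half the distance to all constraints keeps both boxes inside the open domain,
    where only the interior inequalities are tested.\<close>
  define \<rho> where "\<rho> = Min {t0, T - t0, s0, T - s0, x0} / 2"
  have \<rho>: "0 < \<rho>" "\<rho> < t0" "\<rho> < T - t0" "\<rho> < s0" "\<rho> < T - s0" "\<rho> < x0"
    using t0 s0 x0 by (auto simp: \<rho>_def)
  define A1 where "A1 = {t0 - \<rho>..t0 + \<rho>} \<times> {x0 - \<rho>..x0 + \<rho>}"
  define A2 where "A2 = {s0 - \<rho>..s0 + \<rho>} \<times> {x0 - \<rho>..x0 + \<rho>}"
  have sub12: "A1 \<subseteq> solution_domain T" "A2 \<subseteq> solution_domain T"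
    using \<rho> by (auto simp: A1_def A2_def)
  \<comment> \<open>The last three squares make the given maximum strict, so that the maximizers
    must converge to it.\<close>
  define f where "f = (\<lambda>Z. w1 (fst Z) + w2 (snd Z) - (j * (fst (fst Z) - fst (snd Z))\<^sup>2
    + (fst (fst Z) - t0)\<^sup>2 + (fst (snd Z) - s0)\<^sup>2 + (snd (fst Z) - x0)\<^sup>2))"
  define g where "g = (\<lambda>Z::(real \<times> real) \<times> (real \<times> real). (snd (fst Z) - snd (snd Z))\<^sup>2)"
  have comp: "compact (A1 \<times> A2)" unfolding A1_def A2_def by (intro compact_Times compact_Icc)
  have fusc: "upper_semicontinuous_on (A1 \<times> A2) f"
    unfolding f_def
    by (intro upper_semicontinuous_on_diff_continuous upper_semicontinuous_on_add
        upper_semicontinuous_on_compose[OF usc(1)] upper_semicontinuous_on_compose[OF usc(2)]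
        continuous_intros) (use sub12 in auto)
  have gcont: "continuous_on (A1 \<times> A2) g" unfolding g_def by (intro continuous_intros)
  have g_nonneg: "0 \<le> g Y" for Y by (simp add: g_def)
  define Z0 where "Z0 = ((t0, x0), (s0, x0))"
  have Z0: "Z0 \<in> A1 \<times> A2" "g Z0 = 0"
    using \<rho> by (auto simp: Z0_def A1_def A2_def g_def)
  have "\<exists>Z\<in>A1 \<times> A2. \<forall>Y\<in>A1 \<times> A2. f Y - real n * g Y \<le> f Z - real n * g Z" for n
    using Z0(1) by (intro upper_semicontinuous_on_attains_sup comp
        upper_semicontinuous_on_diff_continuous fusc continuous_intros gcont) auto
  then obtain z where z: "\<And>n. z n \<in> A1 \<times> A2"
    "\<And>n Y. Y \<in> A1 \<times> A2 \<Longrightarrow> f Y - real n * g Y \<le> f (z n) - real n * g (z n)" by metis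
  obtain r l where r: "strict_mono r" "l \<in> A1 \<times> A2" "(z \<circ> r) \<longlonglongrightarrow> l" "g l = 0"
    "\<And>y. y \<in> A1 \<times> A2 \<Longrightarrow> g y = 0 \<Longrightarrow> f y \<le> f l"
    by (rule penalized_maximizers_converge[OF comp fusc gcont g_nonneg Z0 z], assumption) (rule that)
  obtain t s x y where l: "l = ((t, x), (s, y))" by (metis surj_pair)
  have xy: "y = x" using r(4) by (simp add: l g_def)
  have "(t, x) \<in> solution_domain T" "(s, x) \<in> solution_domain T"
    using r(2) sub12 unfolding l xy by blast+
  \<comment> \<open>The two abscissas agree at the limit, so \<open>max\<close> applies there and
    forces the localising squares to vanish.\<close>
  then have "(t - t0)\<^sup>2 + (s - s0)\<^sup>2 + (x - x0)\<^sup>2 \<le> 0"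
    using r(5)[OF Z0] max[of t s x] by (simp add: f_def Z0_def l xy)
  then have lZ0: "l = Z0"
    using zero_le_power2[of "t - t0"] zero_le_power2[of "s - s0"] zero_le_power2[of "x - x0"]
    by (simp add: l xy Z0_def sum_power2_le_zero_iff add_nonneg_eq_0_iff order_antisym_conv)
  define tn xn sn yn where "tn = (\<lambda>n. fst (fst (z (r n))))" and "xn = (\<lambda>n. snd (fst (z (r n))))"
    and "sn = (\<lambda>n. fst (snd (z (r n))))" and "yn = (\<lambda>n. snd (snd (z (r n))))"
  have zr: "z (r n) = ((tn n, xn n), (sn n, yn n))" for n
    by (simp add: tn_def xn_def sn_def yn_def)
  have lim: "(\<lambda>n. z (r n)) \<longlonglongrightarrow> Z0" using r(3) lZ0 by (simp add: comp_def)
  have tl: "tn \<longlonglongrightarrow> t0" and xl: "xn \<longlonglongrightarrow> x0" and sl: "sn \<longlonglongrightarrow> s0" and yl: "yn \<longlonglongrightarrow> x0"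
    using tendsto_fst[OF tendsto_fst[OF lim]] tendsto_snd[OF tendsto_fst[OF lim]]
      tendsto_fst[OF tendsto_snd[OF lim]] tendsto_snd[OF tendsto_snd[OF lim]]
    by (simp_all add: tn_def xn_def sn_def yn_def Z0_def)
  have "\<forall>\<^sub>F n in sequentially. \<bar>tn n - t0\<bar> < \<rho> \<and> \<bar>xn n - x0\<bar> < \<rho> \<and> \<bar>sn n - s0\<bar> < \<rho> \<and> \<bar>yn n - x0\<bar> < \<rho>"
    using tendstoD[OF tl \<rho>(1)] tendstoD[OF xl \<rho>(1)] tendstoD[OF sl \<rho>(1)] tendstoD[OF yl \<rho>(1)]
    by eventually_elim (simp add: dist_real_def)
  then obtain N where N: "\<And>n. N \<le> n \<Longrightarrow>
    \<bar>tn n - t0\<bar> < \<rho> \<and> \<bar>xn n - x0\<bar> < \<rho> \<and> \<bar>sn n - s0\<bar> < \<rho> \<and> \<bar>yn n - x0\<bar> < \<rho>"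
    unfolding eventually_sequentially by blast
  \<comment> \<open>The slope tested on \<open>w1\<close>. The localising term in \<open>x\<close>
    is attached to the first point only, so the slope tested on \<open>w2\<close> is
    \<open>- q n\<close> up to \<open>2 * (xn n - x0)\<close>, which tends to 0.\<close>
  define q where "q n = 2 * (xn n - x0) + 2 * real (r n) * (xn n - yn n)" for n
  have le1: "2 * j * (tn n - sn n) + 2 * (tn n - t0) + K1 (tn n, xn n) (q n) \<le> 0" if "N \<le> n" for n
  proof -
    define d where "d = min (\<rho> - \<bar>tn n - t0\<bar>) (\<rho> - \<bar>xn n - x0\<bar>)"
    have "(- 2 * j * sn n - 2 * t0) + 2 * (j + 1) * tn n + K1 (tn n, xn n)
      ((- 2 * x0 - 2 * real (r n) * yn n) + 2 * (1 + real (r n)) * xn n) \<le> 0"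
    proof (rule quadratic_subsolutionD[OF sub(1), where d = d])
      show "0 < d" "0 < tn n" "tn n < T" "xn n \<in> {0<..}"
        using N[OF that] \<rho> by (auto simp: d_def abs_less_iff)
      fix t' x' assume *: "\<bar>t' - tn n\<bar> < d" "\<bar>x' - xn n\<bar> < d"
      have "((t', x'), (sn n, yn n)) \<in> A1 \<times> A2"
        using * N[OF that] unfolding A1_def A2_def d_def mem_Times_iff fst_conv snd_conv
          atLeastAtMost_iff by (intro conjI; linarith)
      from z(2)[OF this, of "r n"] show "w1 (t', x') -
          ((- 2 * j * sn n - 2 * t0) * t' + (j + 1) * t'\<^sup>2 +
           (- 2 * x0 - 2 * real (r n) * yn n) * x' + (1 + real (r n)) * x'\<^sup>2)
        \<le> w1 (tn n, xn n) -
          ((- 2 * j * sn n - 2 * t0) * tn n + (j + 1) * (tn n)\<^sup>2 +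
           (- 2 * x0 - 2 * real (r n) * yn n) * xn n + (1 + real (r n)) * (xn n)\<^sup>2)"
        unfolding zr f_def g_def fst_conv snd_conv by (simp add: power2_eq_square algebra_simps)
    qed
    then show ?thesis by (simp add: q_def algebra_simps)
  qed
  have le2: "- (2 * j * (tn n - sn n)) + 2 * (sn n - s0)
      + K2 (sn n, yn n) (- (q n - 2 * (xn n - x0))) \<le> 0" if "N \<le> n" for n
  proof -
    define d where "d = min (\<rho> - \<bar>sn n - s0\<bar>) (\<rho> - \<bar>yn n - x0\<bar>)"
    have "(- 2 * j * tn n - 2 * s0) + 2 * (j + 1) * sn n + K2 (sn n, yn n)
      ((- 2 * real (r n) * xn n) + 2 * real (r n) * yn n) \<le> 0"
    proof (rule quadratic_subsolutionD[OF sub(2), where d = d])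
      show "0 < d" "0 < sn n" "sn n < T" "yn n \<in> {0<..}"
        using N[OF that] \<rho> by (auto simp: d_def abs_less_iff)
      fix t' x' assume *: "\<bar>t' - sn n\<bar> < d" "\<bar>x' - yn n\<bar> < d"
      have "((tn n, xn n), (t', x')) \<in> A1 \<times> A2"
        using * N[OF that] unfolding A1_def A2_def d_def mem_Times_iff fst_conv snd_conv
          atLeastAtMost_iff by (intro conjI; linarith)
      from z(2)[OF this, of "r n"] show "w2 (t', x') -
          ((- 2 * j * tn n - 2 * s0) * t' + (j + 1) * t'\<^sup>2 +
           (- 2 * real (r n) * xn n) * x' + real (r n) * x'\<^sup>2)
        \<le> w2 (sn n, yn n) -
          ((- 2 * j * tn n - 2 * s0) * sn n + (j + 1) * (sn n)\<^sup>2 +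
           (- 2 * real (r n) * xn n) * yn n + real (r n) * (yn n)\<^sup>2)"
        unfolding zr f_def g_def fst_conv snd_conv by (simp add: power2_eq_square algebra_simps)
    qed
    then show ?thesis by (simp add: q_def algebra_simps)
  qed
  \<comment> \<open>The bound dominates the time derivative in \<open>le1\<close>: both
    \<open>\<bar>tn n - sn n\<bar>\<close> and \<open>\<bar>tn n - t0\<bar>\<close> are at most
    \<open>T\<close>.\<close>
  obtain L where L: "\<And>X p. X \<in> data_domain T \<Longrightarrow> K1 X p \<le> 2 * j * T + 2 * T \<Longrightarrow> \<bar>p\<bar> \<le> L"
    using coercive by blast
  have dom: "(tn n, xn n) \<in> data_domain T" "(sn n, yn n) \<in> data_domain T" for n
    using z(1)[of "r n"] sub12 unfolding zr by fastforce+
  have "q (n + N) \<in> {- L..L}" for n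
  proof -
    have "j * (sn (n + N) - tn (n + N)) \<le> j * T"
      using dom[of "n + N"] j by (intro mult_left_mono) auto
    moreover have "t0 - tn (n + N) \<le> T" using dom(1)[of "n + N"] t0 by auto
    ultimately have "K1 (tn (n + N), xn (n + N)) (q (n + N)) \<le> 2 * j * T + 2 * T"
      using le1[of "n + N"] by (simp add: algebra_simps)
    from L[OF dom(1) this] show ?thesis by auto
  qed
  with compact_Icc[of "- L" L] obtain p r' where p: "strict_mono r'" "((\<lambda>n. q (n + N)) \<circ> r') \<longlonglongrightarrow> p"
    unfolding compact_def by metis
  define k where "k n = r' n + N" for n
  have "strict_mono k" using p(1) by (simp add: k_def strict_mono_def)
  note sub_lim = LIMSEQ_subseq_LIMSEQ[OF _ this, unfolded comp_def]
  have ql: "(\<lambda>n. q (k n)) \<longlonglongrightarrow> p" using p(2) by (simp add: comp_def k_def)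
  have q'l: "(\<lambda>n. - (q (k n) - 2 * (xn (k n) - x0))) \<longlonglongrightarrow> - (p - 2 * (x0 - x0))"
    by (intro tendsto_intros ql sub_lim[OF xl])
  have in_dom: "(t0, x0) \<in> data_domain T" "(s0, x0) \<in> data_domain T" using t0 s0 x0 by auto
  have "(\<lambda>n. K1 (tn (k n), xn (k n)) (q (k n))) \<longlonglongrightarrow> K1 (t0, x0) p"
    using continuous_on_tendsto_compose[OF cont(1)
        tendsto_Pair[OF tendsto_Pair[OF sub_lim[OF tl] sub_lim[OF xl]] ql]] in_dom dom by simp
  then have "(\<lambda>n. 2 * j * (tn (k n) - sn (k n)) + 2 * (tn (k n) - t0) + K1 (tn (k n), xn (k n)) (q (k n)))
      \<longlonglongrightarrow> 2 * j * (t0 - s0) + 2 * (t0 - t0) + K1 (t0, x0) p"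
    by (intro tendsto_intros sub_lim[OF tl] sub_lim[OF sl])
  then have 1: "2 * j * (t0 - s0) + K1 (t0, x0) p \<le> 0"
    using LIMSEQ_le_const2 le1[of "k _"] by (force simp: k_def)
  have "(\<lambda>n. K2 (sn (k n), yn (k n)) (- (q (k n) - 2 * (xn (k n) - x0)))) \<longlonglongrightarrow> K2 (s0, x0) (- p)"
    using continuous_on_tendsto_compose[OF cont(2)
        tendsto_Pair[OF tendsto_Pair[OF sub_lim[OF sl] sub_lim[OF yl]] q'l]] in_dom dom by simp
  then have "(\<lambda>n. - (2 * j * (tn (k n) - sn (k n))) + 2 * (sn (k n) - s0)
        + K2 (sn (k n), yn (k n)) (- (q (k n) - 2 * (xn (k n) - x0))))
      \<longlonglongrightarrow> - (2 * j * (t0 - s0)) + 2 * (s0 - s0) + K2 (s0, x0) (- p)"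
    by (intro tendsto_intros sub_lim[OF tl] sub_lim[OF sl])
  then have 2: "- (2 * j * (t0 - s0)) + K2 (s0, x0) (- p) \<le> 0"
    using LIMSEQ_le_const2 le2[of "k _"] by (force simp: k_def)
  show thesis using that 1 2 by blast
qed

section \<open>Slopes at the boundary\<close>

lemma quadratic_subsolution_centeredD:
  assumes "quadratic_subsolution T S K z" "0 < t" "t < T" "x \<in> S" "0 < d"
    and max: "\<And>t' x'. \<bar>t' - t\<bar> < d \<Longrightarrow> \<bar>x' - x\<bar> < d \<Longrightarrow> 0 \<le> x' \<Longrightarrow>
          z (t', x') - (a * (t' - t0) + k * (t' - t0)\<^sup>2 + m * x' + c * x'\<^sup>2)
            \<le> z (t, x) - (a * (t - t0) + k * (t - t0)\<^sup>2 + m * x + c * x\<^sup>2)"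
  shows "a + 2 * k * (t - t0) + K (t, x) (m + 2 * c * x) \<le> 0"
proof -
  have "(a - 2 * k * t0) + 2 * k * t + K (t, x) (m + 2 * c * x) \<le> 0"
  proof (rule quadratic_subsolutionD[OF assms(1-5)])
    fix t' x' assume "\<bar>t' - t\<bar> < d" "\<bar>x' - x\<bar> < d" "0 \<le> x'"
    from max[OF this] show "z (t', x') - ((a - 2 * k * t0) * t' + k * t'\<^sup>2 + m * x' + c * x'\<^sup>2)
        \<le> z (t, x) - ((a - 2 * k * t0) * t + k * t\<^sup>2 + m * x + c * x\<^sup>2)"
      by (simp add: power2_eq_square algebra_simps)
  qed
  then show ?thesis by (simp add: algebra_simps)
qed

lemma quadratic_perturbation_attains_max:
  assumes usc: "upper_semicontinuous_on (solution_domain T) z"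
    and \<rho>: "0 < \<rho>" "\<rho> < t0" "t0 + \<rho> < T" and r: "0 \<le> r"
  obtains t1 x1 where "\<bar>t1 - t0\<bar> \<le> \<rho>" "0 \<le> x1" "x1 \<le> r"
    "\<And>t x. \<bar>t - t0\<bar> \<le> \<rho> \<Longrightarrow> 0 \<le> x \<Longrightarrow> x \<le> r \<Longrightarrow>
      z (t, x) - (a * (t - t0) + k * (t - t0)\<^sup>2 + m * x + c * x\<^sup>2)
        \<le> z (t1, x1) - (a * (t1 - t0) + k * (t1 - t0)\<^sup>2 + m * x1 + c * x1\<^sup>2)"
proof -
  define f where "f = (\<lambda>X. z X - (a * (fst X - t0) + k * (fst X - t0)\<^sup>2 + m * snd X + c * (snd X)\<^sup>2))"
  define R where "R = {t0 - \<rho>..t0 + \<rho>} \<times> {0..r}"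
  have "R \<subseteq> solution_domain T" using \<rho> by (auto simp: R_def)
  then have "upper_semicontinuous_on R f"
    unfolding f_def by (intro upper_semicontinuous_on_diff_continuous
        upper_semicontinuous_on_subset[OF usc] continuous_intros)
  moreover have "compact R" unfolding R_def by (intro compact_Times compact_Icc)
  moreover have "R \<noteq> {}" using \<rho> r by (auto simp: R_def)
  ultimately obtain X where X: "X \<in> R" "\<And>Y. Y \<in> R \<Longrightarrow> f Y \<le> f X"
    using upper_semicontinuous_on_attains_sup by meson
  obtain t1 x1 where X_eq: "X = (t1, x1)" by (cases X)
  show thesis
  proof (rule that)
    show "\<bar>t1 - t0\<bar> \<le> \<rho>" "0 \<le> x1" "x1 \<le> r" using X(1) by (auto simp: X_eq R_def)
    fix t x assume "\<bar>t - t0\<bar> \<le> \<rho>" "0 \<le> x" "x \<le> r"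
    then have "(t, x) \<in> R" by (auto simp: R_def)
    from X(2)[OF this] show "z (t, x) - (a * (t - t0) + k * (t - t0)\<^sup>2 + m * x + c * x\<^sup>2)
        \<le> z (t1, x1) - (a * (t1 - t0) + k * (t1 - t0)\<^sup>2 + m * x1 + c * x1\<^sup>2)"
      by (simp add: f_def X_eq)
  qed
qed

section \<open>Linear a priori bounds near a boundary point\<close>

lemma uminus_mult_le:
  fixes a x r :: real
  assumes "\<bar>x\<bar> \<le> r"
  shows "- (a * x) \<le> \<bar>a\<bar> * r"
proof -
  have "- (a * x) \<le> \<bar>a\<bar> * \<bar>x\<bar>" using abs_ge_minus_self[of "a * x"] by (simp add: abs_mult)
  also have "\<dots> \<le> \<bar>a\<bar> * r" using assms by (intro mult_left_mono) auto
  finally show ?thesis .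
qed

text \<open>The slope \<open>L\<close> is so steep that \<open>K X L\<close> outweighs any time
  derivative of the test function, so a maximum of the difference over the rectangle cannot be
  interior. The condition \<open>edge\<close> rules out the sides
  \<open>\<bar>t - t0\<bar> = \<rho>\<close> and the second part of \<open>L\<close> the side
  \<open>x = 1\<close>; what remains is \<open>x = 0\<close>, where \<open>axis\<close>
  applies.\<close>

lemma linear_bound_above:
  assumes usc: "upper_semicontinuous_on (solution_domain T) z"
    and sub: "quadratic_subsolution T {0<..} K z"
    and \<rho>: "0 < \<rho>" "\<rho> < t0" "t0 + \<rho> < T" and nonneg: "0 \<le> B"
    and bound: "\<And>X. X \<in> solution_domain T \<Longrightarrow> z X \<le> N"
    and axis: "\<And>t. \<bar>t - t0\<bar> \<le> \<rho> \<Longrightarrow> z (t, 0) \<le> z (t0, 0) + a * (t - t0) + B * (t - t0)\<^sup>2"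
    and edge: "N + \<bar>a\<bar> * \<rho> < z (t0, 0) + B * \<rho>\<^sup>2"
    and L: "0 \<le> L" "N + \<bar>a\<bar> * \<rho> < z (t0, 0) + L"
    and K: "\<And>X. X \<in> data_domain T \<Longrightarrow> \<bar>a\<bar> + 2 * B * \<rho> < K X L"
    and t: "\<bar>t - t0\<bar> \<le> \<rho>" and x: "0 \<le> x" "x \<le> 1"
  shows "z (t, x) \<le> z (t0, 0) + a * (t - t0) + B * (t - t0)\<^sup>2 + L * x"
proof -
  obtain t1 x1 where 1: "\<bar>t1 - t0\<bar> \<le> \<rho>" "0 \<le> x1" "x1 \<le> 1"
    and max: "\<And>t x. \<bar>t - t0\<bar> \<le> \<rho> \<Longrightarrow> 0 \<le> x \<Longrightarrow> x \<le> 1 \<Longrightarrow>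
      z (t, x) - (a * (t - t0) + B * (t - t0)\<^sup>2 + L * x + 0 * x\<^sup>2)
        \<le> z (t1, x1) - (a * (t1 - t0) + B * (t1 - t0)\<^sup>2 + L * x1 + 0 * x1\<^sup>2)"
    using quadratic_perturbation_attains_max[OF usc \<rho> zero_le_one] by metis
  have "x1 = 0"
  proof (rule ccontr)
    assume "x1 \<noteq> 0"
    then have x1: "0 < x1" using 1 by simp
    have z0: "z (t0, 0) \<le> z (t1, x1) - (a * (t1 - t0) + B * (t1 - t0)\<^sup>2 + L * x1)"
      using max[of t0 0] \<rho> by simp
    have zN: "z (t1, x1) \<le> N" using 1 \<rho> by (intro bound) (auto simp: abs_le_iff)
    have at: "- (a * (t1 - t0)) \<le> \<bar>a\<bar> * \<rho>" using 1(1) by (rule uminus_mult_le)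
    have B1: "0 \<le> B * (t1 - t0)\<^sup>2" using nonneg by simp
    have Lx: "0 \<le> L * x1" using L x1 by simp
    have "x1 \<noteq> 1" using z0 zN at B1 L(2) by auto
    moreover have "\<bar>t1 - t0\<bar> \<noteq> \<rho>"
    proof
      assume "\<bar>t1 - t0\<bar> = \<rho>"
      then have "(t1 - t0)\<^sup>2 = \<rho>\<^sup>2" by (metis power2_abs)
      then show False using z0 zN at Lx edge by simp
    qed
    ultimately have lt: "x1 < 1" "\<bar>t1 - t0\<bar> < \<rho>" using 1 by simp_all
    have "a + 2 * B * (t1 - t0) + K (t1, x1) (L + 2 * 0 * x1) \<le> 0"
    proof (rule quadratic_subsolution_centeredD[OF sub, where d = "min (\<rho> - \<bar>t1 - t0\<bar>) (1 - x1)"])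
      show "0 < t1" "t1 < T" "x1 \<in> {0<..}" "0 < min (\<rho> - \<bar>t1 - t0\<bar>) (1 - x1)"
        using \<rho> lt x1 by auto
      fix t' x' assume "\<bar>t' - t1\<bar> < min (\<rho> - \<bar>t1 - t0\<bar>) (1 - x1)"
        "\<bar>x' - x1\<bar> < min (\<rho> - \<bar>t1 - t0\<bar>) (1 - x1)" "0 \<le> x'"
      then show "z (t', x') - (a * (t' - t0) + B * (t' - t0)\<^sup>2 + L * x' + 0 * x'\<^sup>2)
        \<le> z (t1, x1) - (a * (t1 - t0) + B * (t1 - t0)\<^sup>2 + L * x1 + 0 * x1\<^sup>2)"
        by (intro max) linarith+
    qed
    moreover have "- (B * (t1 - t0)) \<le> B * \<rho>"
      using uminus_mult_le[OF 1(1), of B] nonneg by simp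
    moreover have "\<bar>a\<bar> + 2 * B * \<rho> < K (t1, x1) L" using \<rho> lt x1 by (intro K) (auto simp: abs_less_iff)
    ultimately show False by simp
  qed
  then show ?thesis using max[OF t x] axis[OF 1(1)] by simp
qed

text \<open>At slope \<open>- L\<close> both the interior and the boundary operator are too large,
  so the maximum over times in the window and abscissas in \<open>[0, x]\<close> is pushed to the
  side at \<open>x\<close>; its value there is at least the one at \<open>(t0, 0)\<close>. Only some
  time \<open>t\<close> depending on \<open>x\<close> is obtained.\<close>

lemma linear_bound_below:
  assumes usc: "upper_semicontinuous_on (solution_domain T) z"
    and sub: "quadratic_subsolution T {0<..} K z" "quadratic_subsolution T {0} K0 z"
    and \<rho>: "0 < \<rho>" "\<rho> < t0" "t0 + \<rho> < T" and nonneg: "0 \<le> B"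
    and bound: "\<And>X. X \<in> solution_domain T \<Longrightarrow> z X \<le> N"
    and edge: "N + 1 + \<bar>a\<bar> * \<rho> < z (t0, 0) + B * \<rho>\<^sup>2"
    and L: "0 \<le> L"
    and K: "\<And>X. X \<in> data_domain T \<Longrightarrow> \<bar>a\<bar> + 2 * B * \<rho> < K X (- L)"
      "\<And>X. X \<in> data_domain T \<Longrightarrow> \<bar>a\<bar> + 2 * B * \<rho> < K0 X (- L)"
    and x: "0 \<le> x" "L * x \<le> 1"
  shows "\<exists>t. \<bar>t - t0\<bar> \<le> \<rho> \<and> z (t0, 0) + a * (t - t0) + B * (t - t0)\<^sup>2 - L * x \<le> z (t, x)"
proof -
  obtain t1 x1 where 1: "\<bar>t1 - t0\<bar> \<le> \<rho>" "0 \<le> x1" "x1 \<le> x"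
    and max: "\<And>t x'. \<bar>t - t0\<bar> \<le> \<rho> \<Longrightarrow> 0 \<le> x' \<Longrightarrow> x' \<le> x \<Longrightarrow>
      z (t, x') - (a * (t - t0) + B * (t - t0)\<^sup>2 + - L * x' + 0 * x'\<^sup>2)
        \<le> z (t1, x1) - (a * (t1 - t0) + B * (t1 - t0)\<^sup>2 + - L * x1 + 0 * x1\<^sup>2)"
    using quadratic_perturbation_attains_max[OF usc \<rho> x(1)] by metis
  have z0: "z (t0, 0) \<le> z (t1, x1) - (a * (t1 - t0) + B * (t1 - t0)\<^sup>2 - L * x1)"
    using max[of t0 0] \<rho> x by simp
  have "x1 = x"
  proof (rule ccontr)
    assume "x1 \<noteq> x"
    then have x1: "x1 < x" using 1 by simp
    have zN: "z (t1, x1) \<le> N" using 1 \<rho> by (intro bound) (auto simp: abs_le_iff)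
    have at: "- (a * (t1 - t0)) \<le> \<bar>a\<bar> * \<rho>" using 1(1) by (rule uminus_mult_le)
    \<comment> \<open>The drop \<open>L * x1\<close> is at most 1, which is what the extra 1 in
      \<open>edge\<close> pays for.\<close>
    have "L * x1 \<le> L * x" using L 1 by (intro mult_left_mono)
    then have Lx: "L * x1 \<le> 1" using x by simp
    have "\<bar>t1 - t0\<bar> \<noteq> \<rho>"
    proof
      assume "\<bar>t1 - t0\<bar> = \<rho>"
      then have "(t1 - t0)\<^sup>2 = \<rho>\<^sup>2" by (metis power2_abs)
      then show False using z0 zN at Lx edge by simp
    qed
    then have lt: "\<bar>t1 - t0\<bar> < \<rho>" using 1 by simp
    define d where "d = min (\<rho> - \<bar>t1 - t0\<bar>) (x - x1)"
    have d: "0 < t1" "t1 < T" "0 < d" using \<rho> lt x1 by (auto simp: d_def)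
    have near: "z (t', x') - (a * (t' - t0) + B * (t' - t0)\<^sup>2 + - L * x' + 0 * x'\<^sup>2)
        \<le> z (t1, x1) - (a * (t1 - t0) + B * (t1 - t0)\<^sup>2 + - L * x1 + 0 * x1\<^sup>2)"
      if "\<bar>t' - t1\<bar> < d" "\<bar>x' - x1\<bar> < d" "0 \<le> x'" for t' x'
      using that unfolding d_def by (intro max) linarith+
    have "a + 2 * B * (t1 - t0) + K (t1, x1) (- L + 2 * 0 * x1) \<le> 0 \<or>
        a + 2 * B * (t1 - t0) + K0 (t1, x1) (- L + 2 * 0 * x1) \<le> 0"
    proof (cases "x1 = 0")
      case True
      then show ?thesis using quadratic_subsolution_centeredD[OF sub(2) d(1,2) _ d(3) near] by simp
    next
      case False
      then show ?thesis using quadratic_subsolution_centeredD[OF sub(1) d(1,2) _ d(3) near] 1 by simp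
    qed
    moreover have "- (B * (t1 - t0)) \<le> B * \<rho>"
      using uminus_mult_le[OF 1(1), of B] nonneg by simp
    moreover have "(t1, x1) \<in> data_domain T" using d 1 by auto
    note K[OF this]
    ultimately show False by auto
  qed
  then show ?thesis using z0 1 by (intro exI[of _ t1]) simp
qed

text \<open>A boundary counterpart of the spatial superdifferential. The time window
  \<open>\<rho>\<close> is fixed and only the range of \<open>x\<close> may shrink with
  \<open>p\<close>; thus a failure of the bound always supplies a time in the window and an
  arbitrarily small \<open>x\<close>.\<close>

definition eventual_slope_bound ::
    "(real \<times> real \<Rightarrow> real) \<Rightarrow> real \<Rightarrow> real \<Rightarrow> real \<Rightarrow> real \<Rightarrow> real \<Rightarrow> bool" where
  "eventual_slope_bound z t0 \<rho> a k p \<longleftrightarrow>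
     (\<exists>d>0. \<forall>t x. \<bar>t - t0\<bar> \<le> \<rho> \<longrightarrow> 0 \<le> x \<longrightarrow> x < d \<longrightarrow>
        z (t, x) \<le> z (t0, 0) + a * (t - t0) + k * (t - t0)\<^sup>2 + p * x)"

lemma eventual_slope_bound_mono:
  assumes "eventual_slope_bound z t0 \<rho> a k p" "p \<le> q"
  shows "eventual_slope_bound z t0 \<rho> a k q"
proof -
  obtain d where d: "d > 0" "\<And>t x. \<bar>t - t0\<bar> \<le> \<rho> \<Longrightarrow> 0 \<le> x \<Longrightarrow> x < d \<Longrightarrow>
    z (t, x) \<le> z (t0, 0) + a * (t - t0) + k * (t - t0)\<^sup>2 + p * x"
    using assms(1) unfolding eventual_slope_bound_def by blast
  show ?thesis unfolding eventual_slope_bound_def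
  proof (intro exI[of _ d] conjI allI impI d(1))
    fix t x :: real assume x: "\<bar>t - t0\<bar> \<le> \<rho>" "0 \<le> x" "x < d"
    have "p * x \<le> q * x" using assms(2) x by (intro mult_right_mono)
    then show "z (t, x) \<le> z (t0, 0) + a * (t - t0) + k * (t - t0)\<^sup>2 + q * x"
      using d(2)[OF x] by linarith
  qed
qed

lemma eventual_slope_bound_boundary:
  assumes "eventual_slope_bound z t0 \<rho> a k p" "quadratic_subsolution T {0} K z"
    and \<rho>: "0 < \<rho>" "\<rho> < t0" "t0 + \<rho> < T"
  shows "a + K (t0, 0) p \<le> 0"
proof -
  obtain d where d: "d > 0" "\<And>t x. \<bar>t - t0\<bar> \<le> \<rho> \<Longrightarrow> 0 \<le> x \<Longrightarrow> x < d \<Longrightarrow>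
    z (t, x) \<le> z (t0, 0) + a * (t - t0) + k * (t - t0)\<^sup>2 + p * x"
    using assms(1) unfolding eventual_slope_bound_def by blast
  have "a + 2 * k * (t0 - t0) + K (t0, 0) (p + 2 * 0 * 0) \<le> 0"
  proof (rule quadratic_subsolution_centeredD[OF assms(2), where d = "min d \<rho>"])
    fix t' x' :: real assume "\<bar>t' - t0\<bar> < min d \<rho>" "\<bar>x' - 0\<bar> < min d \<rho>" "0 \<le> x'"
    then show "z (t', x') - (a * (t' - t0) + k * (t' - t0)\<^sup>2 + p * x' + 0 * x'\<^sup>2)
      \<le> z (t0, 0) - (a * (t0 - t0) + k * (t0 - t0)\<^sup>2 + p * 0 + 0 * 0\<^sup>2)"
      using d(2)[of t' x'] by simp
  qed (use d(1) \<rho> in auto)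
  then show ?thesis by simp
qed

text \<open>At a boundary point the time localisation is harmless: for a test function of slope near
  \<open>p\<close>, maximizers with abscissa \<open>x\<close> satisfy \<open>(t - t0)\<^sup>2 = O(x)\<close>, so they converge to \<open>t0\<close> as
  \<open>x \<rightarrow> 0\<close>.\<close>

lemma critical_slope:
  assumes usc: "upper_semicontinuous_on (solution_domain T) z"
    and sub: "quadratic_subsolution T {0<..} K z"
    and cont: "continuous_on (data_domain T \<times> UNIV) (\<lambda>(X, p). K X p)"
    and \<rho>: "0 < \<rho>" "\<rho> < t0" "t0 + \<rho> < T" and r: "0 < r" and L: "0 \<le> L"
    and bound: "\<And>t x. \<bar>t - t0\<bar> \<le> \<rho> \<Longrightarrow> 0 \<le> x \<Longrightarrow> x \<le> r \<Longrightarrow>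
      z (t, x) \<le> z (t0, 0) + a * (t - t0) + B * (t - t0)\<^sup>2 + L * x"
    and above: "\<And>\<epsilon>. 0 < \<epsilon> \<Longrightarrow> \<not> eventual_slope_bound z t0 \<rho> a (B + 1) (p - \<epsilon>)"
    and below: "\<And>\<epsilon> d. 0 < \<epsilon> \<Longrightarrow> 0 < d \<Longrightarrow> \<exists>x. 0 < x \<and> x < d \<and> (\<forall>t. \<bar>t - t0\<bar> \<le> \<rho> \<longrightarrow>
      z (t, x) \<le> z (t0, 0) + a * (t - t0) + (B + 1) * (t - t0)\<^sup>2 + (p + \<epsilon>) * x)"
  shows "a + K (t0, 0) p \<le> 0"
proof (rule ccontr)
  assume "\<not> ?thesis"
  then have pos: "0 < a + K (t0, 0) p" by simp
  define k where "k = B + 1"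
  define h where "h = (\<lambda>(X, m). a + 2 * k * (fst X - t0) + K X m)"
  have "continuous_on (data_domain T \<times> UNIV) (\<lambda>Y. a + 2 * k * (fst (fst Y) - t0) + (\<lambda>(X, p). K X p) Y)"
    by (intro continuous_intros cont)
  then have "continuous_on (data_domain T \<times> UNIV) h" by (simp add: h_def case_prod_unfold)
  moreover have "((t0, 0), p) \<in> data_domain T \<times> UNIV" using \<rho> by auto
  ultimately obtain d where d: "d > 0"
    "\<And>Y. Y \<in> data_domain T \<times> UNIV \<Longrightarrow> dist Y ((t0, 0), p) < d \<Longrightarrow> dist (h Y) (h ((t0, 0), p)) < h ((t0, 0), p)"
    using pos unfolding continuous_on_iff by (fastforce simp: h_def)
  have hpos: "0 < a + 2 * k * (t - t0) + K (t, x) m"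
    if "\<bar>t - t0\<bar> \<le> \<rho>" "\<bar>t - t0\<bar> < d / 4" "0 \<le> x" "x < d / 4" "\<bar>m - p\<bar> < d / 4" for t x m
  proof -
    have "dist (t, x) (t0, 0) \<le> \<bar>t - t0\<bar> + \<bar>x\<bar>"
      unfolding dist_Pair_Pair dist_real_def
      using sqrt_sum_squares_le_sum_abs[of "\<bar>t - t0\<bar>" "\<bar>x - 0\<bar>"] by simp
    moreover have "dist ((t, x), m) ((t0, 0), p) \<le> dist (t, x) (t0, 0) + \<bar>m - p\<bar>"
      unfolding dist_Pair_Pair[of "(t, x)" m] dist_real_def
      using sqrt_sum_squares_le_sum_abs[of "dist (t, x) (t0, 0)" "\<bar>m - p\<bar>"] by simp
    ultimately have "dist ((t, x), m) ((t0, 0), p) < d" using that by simp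
    moreover have "((t, x), m) \<in> data_domain T \<times> UNIV" using that \<rho> by auto
    ultimately have "dist (h ((t, x), m)) (h ((t0, 0), p)) < h ((t0, 0), p)" using d(2) by blast
    then show ?thesis by (simp add: h_def dist_real_def)
  qed
  \<comment> \<open>The slopes tested below lie between \<open>p - 2 * \<epsilon>\<close> and
    \<open>p + 4 * \<epsilon>\<close>, hence within \<open>d / 4\<close> of
    \<open>p\<close>.\<close>
  define \<epsilon> where "\<epsilon> = min 1 (d / 32)"
  have \<epsilon>: "0 < \<epsilon>" "\<epsilon> \<le> 1" "4 * \<epsilon> < d / 4" using d(1) by (auto simp: \<epsilon>_def)
  define \<delta> where "\<delta> = min \<rho> (d / 4)"
  define M where "M = L + \<bar>p\<bar> + 2"
  have M: "0 < M" and \<delta>: "0 < \<delta>" using L d(1) \<rho> by (auto simp: M_def \<delta>_def)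
  \<comment> \<open>The requirement that \<open>x2\<close> be below
    \<open>\<delta>\<^sup>2 / M\<close> later gives
    \<open>\<bar>t1 - t0\<bar> < \<delta>\<close>.\<close>
  obtain x2 where x2: "0 < x2" "x2 < min r (min (d / 4) (\<delta>\<^sup>2 / M))"
    and at_x2: "\<And>t. \<bar>t - t0\<bar> \<le> \<rho> \<Longrightarrow>
      z (t, x2) \<le> z (t0, 0) + a * (t - t0) + k * (t - t0)\<^sup>2 + (p + \<epsilon>) * x2"
    using below[OF \<epsilon>(1), of "min r (min (d / 4) (\<delta>\<^sup>2 / M))"] r d(1) M \<delta> unfolding k_def by auto
  obtain t3 x3 where 3: "\<bar>t3 - t0\<bar> \<le> \<rho>" "0 \<le> x3" "x3 < x2 / 3"
    "z (t0, 0) + a * (t3 - t0) + k * (t3 - t0)\<^sup>2 + (p - \<epsilon>) * x3 < z (t3, x3)"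
    using above[OF \<epsilon>(1)] x2(1) unfolding eventual_slope_bound_def k_def
    by (metis not_le zero_less_divide_iff zero_less_numeral)
  \<comment> \<open>The parabola \<open>m * x + c * x\<^sup>2\<close> has chord slope
    \<open>p + \<epsilon>\<close> at \<open>x2\<close>, and at most \<open>p - \<epsilon>\<close> up
    to \<open>x2 / 3\<close>. Hence \<open>(t3, x3)\<close> beats the value at
    \<open>(t0, 0)\<close> and no point with abscissa \<open>x2\<close> does, so the maximizer has
    \<open>x1 < x2\<close>.\<close>
  define m where "m = p - 2 * \<epsilon>"
  define c where "c = 3 * \<epsilon> / x2"
  have c: "c * x2 = 3 * \<epsilon>" "0 < c" using x2 \<epsilon> by (auto simp: c_def)
  obtain t1 x1 where 1: "\<bar>t1 - t0\<bar> \<le> \<rho>" "0 \<le> x1" "x1 \<le> x2"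
    and max: "\<And>t x. \<bar>t - t0\<bar> \<le> \<rho> \<Longrightarrow> 0 \<le> x \<Longrightarrow> x \<le> x2 \<Longrightarrow>
      z (t, x) - (a * (t - t0) + k * (t - t0)\<^sup>2 + m * x + c * x\<^sup>2)
        \<le> z (t1, x1) - (a * (t1 - t0) + k * (t1 - t0)\<^sup>2 + m * x1 + c * x1\<^sup>2)"
    using quadratic_perturbation_attains_max[OF usc \<rho>, of x2] x2(1) by (metis less_imp_le)
  have "c * x3\<^sup>2 \<le> \<epsilon> * x3"
  proof -
    have "c * x3 \<le> c * (x2 / 3)" using 3 c by (intro mult_left_mono) auto
    then have "(c * x3) * x3 \<le> \<epsilon> * x3" using c 3 by (intro mult_right_mono) auto
    then show ?thesis by (simp add: power2_eq_square mult.assoc)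
  qed
  then have val: "z (t0, 0) < z (t1, x1) - (a * (t1 - t0) + k * (t1 - t0)\<^sup>2 + m * x1 + c * x1\<^sup>2)"
    using max[of t3 x3] 3 x2 by (simp add: m_def algebra_simps)
  have up: "z (t1, x1) \<le> z (t0, 0) + a * (t1 - t0) + B * (t1 - t0)\<^sup>2 + L * x1"
    using bound[of t1 x1] 1 x2 by auto
  \<comment> \<open>The a priori bound has time coefficient \<open>B\<close> and the test function
    \<open>B + 1\<close>; the surplus is the square that controls \<open>t1\<close>. The same
    inequality excludes \<open>x1 = 0\<close>.\<close>
  have tau: "(t1 - t0)\<^sup>2 + c * x1\<^sup>2 < (L - m) * x1"
    using val up by (simp add: k_def algebra_simps)
  have "x1 \<noteq> 0" using tau zero_le_power2[of "t1 - t0"] by auto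
  moreover have "x1 \<noteq> x2"
  proof
    assume "x1 = x2"
    moreover have "c * x2\<^sup>2 = 3 * \<epsilon> * x2" unfolding c(1)[symmetric] by (simp add: power2_eq_square)
    ultimately show False
      using val at_x2[OF 1(1)] by (simp add: m_def algebra_simps)
  qed
  ultimately have x1: "0 < x1" "x1 < x2" using 1 by auto
  have "(t1 - t0)\<^sup>2 < \<delta>\<^sup>2"
  proof -
    have "0 \<le> c * x1\<^sup>2" using c by simp
    then have "(t1 - t0)\<^sup>2 < (L - m) * x1" using tau by simp
    also have "\<dots> \<le> M * x1" using x1 \<epsilon> by (intro mult_right_mono) (auto simp: M_def m_def)
    also have "\<dots> \<le> M * x2" using x1 M by simp
    also have "\<dots> \<le> \<delta>\<^sup>2" using x2 M by (simp add: field_simps)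
    finally show ?thesis .
  qed
  then have t1: "\<bar>t1 - t0\<bar> < \<delta>" using \<delta> by (metis abs_le_square_iff abs_of_pos not_le)
  have "a + 2 * k * (t1 - t0) + K (t1, x1) (m + 2 * c * x1) \<le> 0"
  proof (rule quadratic_subsolution_centeredD[OF sub, where d = "min (\<rho> - \<bar>t1 - t0\<bar>) (x2 - x1)"])
    show "0 < t1" "t1 < T" "x1 \<in> {0<..}" "0 < min (\<rho> - \<bar>t1 - t0\<bar>) (x2 - x1)"
      using \<rho> t1 x1 by (auto simp: \<delta>_def)
    fix t' x' assume "\<bar>t' - t1\<bar> < min (\<rho> - \<bar>t1 - t0\<bar>) (x2 - x1)"
      "\<bar>x' - x1\<bar> < min (\<rho> - \<bar>t1 - t0\<bar>) (x2 - x1)" "0 \<le> x'"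
    then show "z (t', x') - (a * (t' - t0) + k * (t' - t0)\<^sup>2 + m * x' + c * x'\<^sup>2)
        \<le> z (t1, x1) - (a * (t1 - t0) + k * (t1 - t0)\<^sup>2 + m * x1 + c * x1\<^sup>2)"
      by (intro max) linarith+
  qed
  moreover have "0 \<le> c * x1" "c * x1 \<le> c * x2" using c(2) x1 by (simp_all add: mult_left_mono)
  then have "\<bar>m + 2 * c * x1 - p\<bar> < d / 4" using c(1) \<epsilon> unfolding m_def abs_less_iff by linarith
  then have "0 < a + 2 * k * (t1 - t0) + K (t1, x1) (m + 2 * c * x1)"
    using hpos[of t1 x1] 1 t1 x1 x2 by (auto simp: \<delta>_def)
  ultimately show False by simp
qed

text \<open>The infimum \<open>p0\<close> of \<open>P\<close> lies in \<open>A\<close>, while some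
  \<open>q0\<close> above it lies outside \<open>A\<close> with \<open>Q\<close> holding below
  \<open>q0\<close>. Strictly between them \<open>P\<close> and \<open>Q\<close> both hold; by
  closedness \<open>[p0, q0]\<close> lies in \<open>D\<close> and is covered by \<open>A\<close> and
  \<open>B\<close>, which are disjoint on it. Both meet it, against connectedness.\<close>

lemma slope_dichotomy_absurd:
  fixes A B D :: "real set"
  assumes closed: "closed A" "closed B" "closed D" and disjoint: "D \<inter> A \<inter> B = {}"
    and P_mono: "\<And>p q. P p \<Longrightarrow> p \<le> q \<Longrightarrow> P q" and P: "P L" "\<And>p. P p \<Longrightarrow> l \<le> p"
    and Q_mono: "\<And>p q. Q q \<Longrightarrow> p \<le> q \<Longrightarrow> Q p"
    and cover: "\<And>p. P p \<or> Q p"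
    and P_AB: "\<And>p. P p \<Longrightarrow> p \<in> A \<union> B" and Q_D: "\<And>p. Q p \<Longrightarrow> p \<in> D"
    and inf_P: "\<And>p. (\<And>\<epsilon>. 0 < \<epsilon> \<Longrightarrow> \<not> P (p - \<epsilon>)) \<Longrightarrow> (\<And>\<epsilon>. 0 < \<epsilon> \<Longrightarrow> P (p + \<epsilon>)) \<Longrightarrow> p \<in> A"
    and sup_Q: "\<And>p. (\<And>\<epsilon>. 0 < \<epsilon> \<Longrightarrow> Q (p - \<epsilon>)) \<Longrightarrow> (\<And>\<epsilon>. 0 < \<epsilon> \<Longrightarrow> \<not> Q (p + \<epsilon>)) \<Longrightarrow> p \<notin> A"
    and L: "L \<notin> A"
  shows False
proof -
  define p0 where "p0 = Inf {p. P p}"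
  have bdd: "bdd_below {p. P p}" using P(2) by (intro bdd_belowI[of _ l]) simp
  have notP: "\<not> P p" if "p < p0" for p
    using cInf_lower[OF _ bdd, of p] that by (auto simp: p0_def)
  have isP: "P p" if "p0 < p" for p
  proof -
    have "{p. P p} \<noteq> {}" using P(1) by blast
    from cInf_lessD[OF this] that show ?thesis using P_mono by (auto simp: p0_def dest: less_imp_le)
  qed
  have p0A: "p0 \<in> A" using notP isP by (intro inf_P) auto
  have Q_below: "Q p" if "p < p0" for p using cover notP that by blast
  \<comment> \<open>If \<open>Q\<close> reaches \<open>L\<close>, then \<open>L\<close> itself,
    outside \<open>A\<close>, serves as right end; otherwise the supremum of \<open>Q\<close> is
    finite and critical.\<close>
  obtain q0 where q0: "p0 \<le> q0" "q0 \<notin> A" "\<And>p. p < q0 \<Longrightarrow> Q p"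
  proof (cases "Q L")
    case True
    have "p0 \<le> L" using notP P(1) by (meson not_le)
    then show ?thesis using that[of L] L True Q_mono by (meson less_imp_le)
  next
    case False
    define q0 where "q0 = Sup {p. Q p}"
    have bddQ: "bdd_above {p. Q p}" using False Q_mono by (intro bdd_aboveI[of _ L]) (meson mem_Collect_eq linear)
    have ne: "{p. Q p} \<noteq> {}" using Q_below[of "p0 - 1"] by auto
    have notQ: "\<not> Q p" if "q0 < p" for p
      using cSup_upper[OF _ bddQ, of p] that by (auto simp: q0_def)
    have isQ: "Q p" if "p < q0" for p
      using less_cSupD[OF ne] that Q_mono by (auto simp: q0_def dest: less_imp_le)
    have "p0 \<le> q0" using notQ Q_below by (meson dense_le not_le)
    moreover have "q0 \<notin> A" using isQ notQ by (intro sup_Q) auto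
    ultimately show ?thesis using that isQ by blast
  qed
  have lt: "p0 < q0" using p0A q0 by (metis order_le_less)
  have cl: "closure {p0<..<q0} = {p0..q0}" using lt by (rule closure_greaterThanLessThan)
  have AB: "{p0..q0} \<subseteq> A \<union> B"
    unfolding cl[symmetric]
    by (intro closure_minimal closed_Un closed subsetI P_AB isP) simp
  have D: "{p0..q0} \<subseteq> D"
    unfolding cl[symmetric] using q0 Q_D closed by (intro closure_minimal) auto
  have "A \<inter> B \<inter> {p0..q0} = {}" using D disjoint by blast
  moreover have "p0 \<in> A \<inter> {p0..q0}" using p0A lt by simp
  moreover have "q0 \<in> B \<inter> {p0..q0}" using q0(2) lt subsetD[OF AB, of q0] by simp
  ultimately have "\<not> connected {p0..q0}"
    using AB closed unfolding connected_closed by blast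
  then show False by simp
qed

section \<open>Excluding a maximum at the boundary\<close>

lemma continuous_on_case_prod_add_const:
  fixes G :: "'a::topological_space \<Rightarrow> real \<Rightarrow> real"
  assumes "continuous_on (S \<times> UNIV) (\<lambda>(X, p). G X p)"
  shows "continuous_on (S \<times> UNIV) (\<lambda>(X, p). G X p + c)"
  using continuous_on_add[OF assms continuous_on_const[of _ c]] by (simp add: case_prod_unfold)

lemma continuous_on_case_prod_reflect:
  fixes G :: "'a::topological_space \<Rightarrow> real \<Rightarrow> real"
  assumes "continuous_on (S \<times> UNIV) (\<lambda>(X, p). G X p)"
  shows "continuous_on (S \<times> UNIV) (\<lambda>(X, p). - G X (- p))"
proof -
  have "continuous_on (S \<times> UNIV) (\<lambda>Y. (\<lambda>(X, p). G X p) (fst Y, - snd Y))"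
    by (rule continuous_on_compose2[OF assms]) (auto intro!: continuous_intros)
  then show ?thesis using continuous_on_minus by (force simp: case_prod_unfold)
qed

text \<open>The slope sets of \<open>z1\<close> at \<open>t0\<close> and of \<open>z2\<close> at
  \<open>s0\<close> are brought into the form of \<open>slope_dichotomy_absurd\<close>. Here
  \<open>z2\<close> stands for the penalised \<open>- v\<close>, and \<open>gap_H\<close>,
  \<open>gap_F\<close> carry all that is kept of the time regularity.\<close>

lemma boundary_maximum_absurd:
  fixes H F :: "real \<times> real \<Rightarrow> real \<Rightarrow> real" and z1 z2 :: "real \<times> real \<Rightarrow> real"
  assumes usc: "upper_semicontinuous_on (solution_domain T) z1"
      "upper_semicontinuous_on (solution_domain T) z2"
    and sub1: "quadratic_subsolution T {0<..} (\<lambda>X p. H X p + e) z1"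
      "quadratic_subsolution T {0} (\<lambda>X p. min (F X p) (H X p) + e) z1"
    and sub2: "quadratic_subsolution T {0<..} (\<lambda>X p. - H X (- p)) z2"
      "quadratic_subsolution T {0} (\<lambda>X p. - max (F X (- p)) (H X (- p))) z2"
    and cont: "continuous_on (data_domain T \<times> UNIV) (\<lambda>(X, p). H X p)"
      "continuous_on (data_domain T \<times> UNIV) (\<lambda>(X, p). F X p)"
    and coercive: "\<And>M. \<exists>L. \<forall>X\<in>data_domain T. \<forall>p. H X p \<le> M \<longrightarrow> \<bar>p\<bar> \<le> L"
      "\<And>M. \<exists>L. \<forall>X\<in>data_domain T. \<forall>p. F X p \<le> M \<longrightarrow> - L \<le> p"
    and bound: "\<And>X. X \<in> solution_domain T \<Longrightarrow> z1 X \<le> N"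
    and t0: "0 < t0" "t0 < T" and s0: "0 < s0" "s0 < T" and j: "0 \<le> j"
    and max: "\<And>t s x. 0 \<le> t \<Longrightarrow> t < T \<Longrightarrow> 0 \<le> s \<Longrightarrow> s < T \<Longrightarrow> 0 \<le> x \<Longrightarrow>
      z1 (t, x) + z2 (s, x) - j * (t - s)\<^sup>2 \<le> z1 (t0, 0) + z2 (s0, 0) - j * (t0 - s0)\<^sup>2"
    and a: "a = 2 * j * (t0 - s0)"
    and gap_H: "\<And>p. H (t0, 0) p \<le> - a - e \<Longrightarrow> H (s0, 0) p < - a"
    and gap_F: "\<And>p. H (t0, 0) p \<le> - a - e \<Longrightarrow> F (t0, 0) p \<le> - a - e \<Longrightarrow> F (s0, 0) p < - a"
  shows False
proof -
  define \<rho> where "\<rho> = min (min t0 (T - t0)) (min s0 (T - s0)) / 2"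
  have \<rho>: "0 < \<rho>" "\<rho> < t0" "t0 + \<rho> < T" "\<rho> < s0" "s0 + \<rho> < T"
  proof -
    have "2 * \<rho> \<le> t0" "2 * \<rho> \<le> T - t0" "2 * \<rho> \<le> s0" "2 * \<rho> \<le> T - s0" "0 < \<rho>"
      using t0 s0 by (auto simp: \<rho>_def)
    then show "0 < \<rho>" "\<rho> < t0" "t0 + \<rho> < T" "\<rho> < s0" "s0 + \<rho> < T" by linarith+
  qed
  \<comment> \<open>The part \<open>2 * j\<close> absorbs the coupling term between the two times;
    the quotient makes \<open>B * \<rho>\<^sup>2\<close> large enough to keep maxima off the ends of
    the time window.\<close>
  define B where "B = 2 * j + (\<bar>N\<bar> + 2 + \<bar>a\<bar> * \<rho> + \<bar>z1 (t0, 0)\<bar>) / \<rho>\<^sup>2"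
  have frac: "0 \<le> (\<bar>N\<bar> + 2 + \<bar>a\<bar> * \<rho> + \<bar>z1 (t0, 0)\<bar>) / \<rho>\<^sup>2" using \<rho> by simp
  then have B: "2 * j \<le> B" "j \<le> B" "0 \<le> B" using j by (auto simp: B_def)
  have "(\<bar>N\<bar> + 2 + \<bar>a\<bar> * \<rho> + \<bar>z1 (t0, 0)\<bar>) / \<rho>\<^sup>2 \<le> B" using j by (simp add: B_def)
  then have "\<bar>N\<bar> + 2 + \<bar>a\<bar> * \<rho> + \<bar>z1 (t0, 0)\<bar> \<le> B * \<rho>\<^sup>2"
    using \<rho> by (simp add: pos_divide_le_eq)
  then have edge: "N + 1 + \<bar>a\<bar> * \<rho> < z1 (t0, 0) + B * \<rho>\<^sup>2" by linarith
  define M where "M = \<bar>a\<bar> + 2 * B * \<rho> + \<bar>e\<bar>"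
  obtain L1 where L1: "\<And>X p. X \<in> data_domain T \<Longrightarrow> H X p \<le> M \<Longrightarrow> \<bar>p\<bar> \<le> L1"
    using coercive(1)[of M] by blast
  obtain L2 where L2: "\<And>X p. X \<in> data_domain T \<Longrightarrow> F X p \<le> M \<Longrightarrow> - L2 \<le> p"
    using coercive(2)[of M] by blast
  \<comment> \<open>\<open>L\<close> exceeds both coercivity thresholds, and its remaining terms
    exclude a maximum at \<open>x = 1\<close>.\<close>
  define L where "L = \<bar>L1\<bar> + \<bar>L2\<bar> + \<bar>N\<bar> + \<bar>a\<bar> * \<rho> + \<bar>z1 (t0, 0)\<bar> + 1"
  have "0 \<le> \<bar>a\<bar> * \<rho>" using \<rho> by simp
  then have L: "1 \<le> L" "L1 < L" "L2 < L" "N + \<bar>a\<bar> * \<rho> < z1 (t0, 0) + L" by (auto simp: L_def)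
  have HL: "M < H X L" "M < H X (- L)" if "X \<in> data_domain T" for X
    using L1[OF that, of L] L1[OF that, of "- L"] L by (force simp: not_le[symmetric])+
  have FL: "M < F X (- L)" if "X \<in> data_domain T" for X
    using L2[OF that, of "- L"] L by force
  have in_dom: "(t0, 0) \<in> data_domain T" "(s0, 0) \<in> data_domain T" using t0 s0 by auto
  have B\<rho>: "0 \<le> B * \<rho>" using B \<rho> by simp
  \<comment> \<open>Expanding \<open>j * (t - s)\<^sup>2\<close> about \<open>(t0, s0)\<close> and
    using \<open>(\<tau> - \<sigma>)\<^sup>2 \<le> 2 * \<tau>\<^sup>2 + 2 * \<sigma>\<^sup>2\<close>
    decouples the times. The abscissa is shared, so a lower bound for one function at one time
    bounds the other above at every time of its window.\<close>
  have split: "z1 (t, x) + z2 (s, x) \<le> z1 (t0, 0) + a * (t - t0) + B * (t - t0)\<^sup>2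
      + (z2 (s0, 0) - a * (s - s0) + B * (s - s0)\<^sup>2)"
    if "\<bar>t - t0\<bar> \<le> \<rho>" "\<bar>s - s0\<bar> \<le> \<rho>" "0 \<le> x" for t s x
  proof -
    define \<tau> \<sigma> where "\<tau> = t - t0" and "\<sigma> = s - s0"
    have "j * (\<tau> - \<sigma>)\<^sup>2 \<le> j * (2 * \<tau>\<^sup>2 + 2 * \<sigma>\<^sup>2)"
      using j zero_le_power2[of "\<tau> + \<sigma>"]
      by (intro mult_left_mono) (auto simp: power2_eq_square algebra_simps)
    also have "\<dots> = 2 * j * (\<tau>\<^sup>2 + \<sigma>\<^sup>2)" by (simp add: algebra_simps)
    also have "\<dots> \<le> B * (\<tau>\<^sup>2 + \<sigma>\<^sup>2)" using B by (intro mult_right_mono) auto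
    finally have "j * (\<tau> - \<sigma>)\<^sup>2 \<le> B * \<tau>\<^sup>2 + B * \<sigma>\<^sup>2" by (simp add: algebra_simps)
    moreover have "j * (t - s)\<^sup>2 - j * (t0 - s0)\<^sup>2 = a * \<tau> - a * \<sigma> + j * (\<tau> - \<sigma>)\<^sup>2"
      by (simp add: a \<tau>_def \<sigma>_def power2_eq_square algebra_simps)
    ultimately show ?thesis
      using max[of t s x] that \<rho> unfolding \<tau>_def \<sigma>_def by (auto simp: abs_le_iff)
  qed
  have axis: "z1 (t, 0) \<le> z1 (t0, 0) + a * (t - t0) + B * (t - t0)\<^sup>2" if "\<bar>t - t0\<bar> \<le> \<rho>" for t
    using split[of t s0 0] that \<rho> by simp
  have bound1: "z1 (t, x) \<le> z1 (t0, 0) + a * (t - t0) + B * (t - t0)\<^sup>2 + L * x"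
    if "\<bar>t - t0\<bar> \<le> \<rho>" "0 \<le> x" "x \<le> 1 / L" for t x
  proof (rule linear_bound_above[OF usc(1) sub1(1) \<rho>(1-3) B(3) bound axis])
    show "N + \<bar>a\<bar> * \<rho> < z1 (t0, 0) + B * \<rho>\<^sup>2" using edge by simp
    show "\<bar>a\<bar> + 2 * B * \<rho> < H X L + e" if "X \<in> data_domain T" for X
      using HL(1)[OF that] unfolding M_def by linarith
    have "1 / L \<le> 1" using L by simp
    then show "x \<le> 1" using that by simp
  qed (use that L in auto)
  \<comment> \<open>The operator \<open>- H X (- p)\<close> is not coercive from above, so
    \<open>linear_bound_above\<close> does not apply to \<open>z2\<close>. The bound is transferred
    through \<open>split\<close> from the slowest possible decrease of \<open>z1\<close>.\<close>
  have bound2: "z2 (s, x) \<le> z2 (s0, 0) + (- a) * (s - s0) + B * (s - s0)\<^sup>2 + L * x"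
    if "\<bar>s - s0\<bar> \<le> \<rho>" "0 \<le> x" "x \<le> 1 / L" for s x
  proof -
    have "\<exists>t. \<bar>t - t0\<bar> \<le> \<rho> \<and> z1 (t0, 0) + a * (t - t0) + B * (t - t0)\<^sup>2 - L * x \<le> z1 (t, x)"
    proof (rule linear_bound_below[OF usc(1) sub1 \<rho>(1-3) B(3) bound edge])
      fix X :: "real \<times> real" assume X: "X \<in> data_domain T"
      show "\<bar>a\<bar> + 2 * B * \<rho> < H X (- L) + e" using HL(2)[OF X] unfolding M_def by linarith
      show "\<bar>a\<bar> + 2 * B * \<rho> < min (F X (- L)) (H X (- L)) + e"
        using HL(2)[OF X] FL[OF X] unfolding M_def by linarith
    qed (use that L in \<open>auto simp: field_simps\<close>)
    then obtain t where "\<bar>t - t0\<bar> \<le> \<rho>"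
      "z1 (t0, 0) + a * (t - t0) + B * (t - t0)\<^sup>2 - L * x \<le> z1 (t, x)" by blast
    with split[of t s x] that show ?thesis by simp
  qed
  define P where "P = eventual_slope_bound z1 t0 \<rho> a (B + 1)"
  \<comment> \<open>The sign turns an upper slope of \<open>z2\<close> into a lower slope of the
    penalised \<open>v\<close>, which makes \<open>Q\<close> downward closed. The coefficient
    \<open>B + 1\<close> is the surplus over the a priori bounds that \<open>critical_slope\<close>
    uses.\<close>
  define Q where "Q p = eventual_slope_bound z2 s0 \<rho> (- a) (B + 1) (- p)" for p
  have r: "0 < 1 / L" using L by simp
  have bound_imp_slope: "eventual_slope_bound z t \<rho> b (B + 1) L"
    if "\<And>s x. \<bar>s - t\<bar> \<le> \<rho> \<Longrightarrow> 0 \<le> x \<Longrightarrow> x \<le> 1 / L \<Longrightarrow>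
      z (s, x) \<le> z (t, 0) + b * (s - t) + B * (s - t)\<^sup>2 + L * x"
    for z :: "real \<times> real \<Rightarrow> real" and t b
    unfolding eventual_slope_bound_def
  proof (intro exI[of _ "1 / L"] conjI r allI impI)
    fix s x :: real assume "\<bar>s - t\<bar> \<le> \<rho>" "0 \<le> x" "x < 1 / L"
    with that[of s x] show "z (s, x) \<le> z (t, 0) + b * (s - t) + (B + 1) * (s - t)\<^sup>2 + L * x"
      using zero_le_power2[of "s - t"] unfolding distrib_right[of B 1] by linarith
  qed
  have PL: "P L" unfolding P_def by (rule bound_imp_slope[OF bound1])
  have P_sub: "min (F (t0, 0) p) (H (t0, 0) p) \<le> - a - e" if "P p" for p
    using eventual_slope_bound_boundary[OF that[unfolded P_def] sub1(2) \<rho>(1-3)] by simp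
  have Q_sup: "- a \<le> max (F (s0, 0) p) (H (s0, 0) p)" if "Q p" for p
    using eventual_slope_bound_boundary[OF that[unfolded Q_def] sub2(2) \<rho>(1,4,5)] by simp
  have P_mono: "P q" if "P p" "p \<le> q" for p q
    using eventual_slope_bound_mono that unfolding P_def by blast
  have Q_mono: "Q p" if "Q q" "p \<le> q" for p q
    using eventual_slope_bound_mono[of z2 s0 \<rho> "- a" "B + 1" "- q" "- p"] that unfolding Q_def by simp
  note cont1 = continuous_on_case_prod_add_const[OF cont(1), of e]
  note cont2 = continuous_on_case_prod_reflect[OF cont(1)]
  note slope1 = critical_slope[OF usc(1) sub1(1) cont1 \<rho>(1-3) r _ bound1]
  note slope2 = critical_slope[OF usc(2) sub2(1) cont2 \<rho>(1,4,5) r _ bound2]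
  have L0: "0 \<le> L" using L by simp
  have slope_imp_below: "\<exists>x. 0 < x \<and> x < d \<and> (\<forall>s. \<bar>s - t\<bar> \<le> \<rho> \<longrightarrow>
      z (s, x) \<le> z (t, 0) + b * (s - t) + (B + 1) * (s - t)\<^sup>2 + p * x)"
    if slope: "eventual_slope_bound z t \<rho> b (B + 1) p" and d: "0 < d" for z t b p d
  proof -
    obtain d' where d': "0 < d'" "\<And>s x. \<bar>s - t\<bar> \<le> \<rho> \<Longrightarrow> 0 \<le> x \<Longrightarrow> x < d' \<Longrightarrow>
      z (s, x) \<le> z (t, 0) + b * (s - t) + (B + 1) * (s - t)\<^sup>2 + p * x"
      using slope unfolding eventual_slope_bound_def by blast
    define x where "x = min d d' / 2"
    have "0 < x" "x < d" "x < d'" using d d'(1) by (auto simp: x_def)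
    then show ?thesis using d'(2) by (intro exI[of _ x] conjI allI impI) simp_all
  qed
  define A where "A = {p. H (t0, 0) p \<le> - a - e}"
  define B' where "B' = {p. F (t0, 0) p \<le> - a - e}"
  define D where "D = {p. - a \<le> max (F (s0, 0) p) (H (s0, 0) p)}"
  have inf_P: "p \<in> A" if "\<And>\<epsilon>. 0 < \<epsilon> \<Longrightarrow> \<not> P (p - \<epsilon>)" "\<And>\<epsilon>. 0 < \<epsilon> \<Longrightarrow> P (p + \<epsilon>)" for p
    using slope1[of p, OF L0 _ _ _ that(1)[unfolded P_def] slope_imp_below[OF that(2)[unfolded P_def]]]
    by (simp add: A_def)
  have sup_Q: "p \<notin> A" if "\<And>\<epsilon>. 0 < \<epsilon> \<Longrightarrow> Q (p - \<epsilon>)" "\<And>\<epsilon>. 0 < \<epsilon> \<Longrightarrow> \<not> Q (p + \<epsilon>)" for p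
  proof -
    have n: "\<not> eventual_slope_bound z2 s0 \<rho> (- a) (B + 1) (- p - \<epsilon>)" if "0 < \<epsilon>" for \<epsilon>
      using \<open>\<And>\<epsilon>. 0 < \<epsilon> \<Longrightarrow> \<not> Q (p + \<epsilon>)\<close>[OF that] by (simp add: Q_def)
    have y: "eventual_slope_bound z2 s0 \<rho> (- a) (B + 1) (- p + \<epsilon>)" if "0 < \<epsilon>" for \<epsilon>
      using \<open>\<And>\<epsilon>. 0 < \<epsilon> \<Longrightarrow> Q (p - \<epsilon>)\<close>[OF that] by (simp add: Q_def)
    have "- a \<le> H (s0, 0) p"
      using slope2[of "- p", OF L0 _ _ _ n slope_imp_below[OF y]] by simp
    then show ?thesis using gap_H[of p] by (auto simp: A_def)
  qed
  \<comment> \<open>Where \<open>z2\<close> exceeds slope \<open>- p\<close>, \<open>split\<close>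
    puts \<open>z1\<close> below slope \<open>p\<close> at the same abscissa for all times, and
    conversely. So a slope outside both sets is critical for both functions. The abscissas are
    merely arbitrarily small, which is why \<open>critical_slope\<close> asks for no more in
    \<open>below\<close>.\<close>
  have cover: "P p \<or> Q p" for p
  proof (rule ccontr)
    assume "\<not> (P p \<or> Q p)"
    then have nP: "\<not> P p" and nQ: "\<not> Q p" by auto
    have above1: "\<not> eventual_slope_bound z1 t0 \<rho> a (B + 1) (p - \<epsilon>)" if "0 < \<epsilon>" for \<epsilon>
      using nP P_mono[of "p - \<epsilon>" p] that unfolding P_def by auto
    have above2: "\<not> eventual_slope_bound z2 s0 \<rho> (- a) (B + 1) (- p - \<epsilon>)" if "0 < \<epsilon>" for \<epsilon>
      using nQ Q_mono[of "p + \<epsilon>" p] that unfolding Q_def by auto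
    have split': "z1 (t, x) + z2 (s, x) \<le> z1 (t0, 0) + a * (t - t0) + (B + 1) * (t - t0)\<^sup>2
      + (z2 (s0, 0) - a * (s - s0) + (B + 1) * (s - s0)\<^sup>2)"
      if "\<bar>t - t0\<bar> \<le> \<rho>" "\<bar>s - s0\<bar> \<le> \<rho>" "0 \<le> x" for t s x
      using split[OF that] zero_le_power2[of "t - t0"] zero_le_power2[of "s - s0"]
      unfolding distrib_right[of B 1] by linarith
    have below1: "\<exists>x. 0 < x \<and> x < d \<and> (\<forall>t. \<bar>t - t0\<bar> \<le> \<rho> \<longrightarrow>
      z1 (t, x) \<le> z1 (t0, 0) + a * (t - t0) + (B + 1) * (t - t0)\<^sup>2 + (p + \<epsilon>) * x)"
      if \<epsilon>: "0 < \<epsilon>" and d: "0 < d" for \<epsilon> d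
    proof -
      obtain s x where x: "\<bar>s - s0\<bar> \<le> \<rho>" "0 \<le> x" "x < d"
        "z2 (s0, 0) + (- a) * (s - s0) + (B + 1) * (s - s0)\<^sup>2 + (- p) * x < z2 (s, x)"
        using nQ d unfolding Q_def eventual_slope_bound_def by (meson not_le)
      \<comment> \<open>At \<open>x = 0\<close> the a priori bound, whose time coefficient is only
        \<open>B\<close>, contradicts the strict excess.\<close>
      have "x \<noteq> 0"
        using x bound2[of s 0] r zero_le_power2[of "s - s0"] unfolding distrib_right[of B 1] by force
      moreover have "0 \<le> \<epsilon> * x" using \<epsilon> x by simp
      then have "z1 (t, x) \<le> z1 (t0, 0) + a * (t - t0) + (B + 1) * (t - t0)\<^sup>2 + (p + \<epsilon>) * x"
        if "\<bar>t - t0\<bar> \<le> \<rho>" for t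
        using split'[OF that x(1,2)] x(4) by (simp add: algebra_simps)
      ultimately show ?thesis using x by (intro exI[of _ x]) auto
    qed
    have below2: "\<exists>x. 0 < x \<and> x < d \<and> (\<forall>s. \<bar>s - s0\<bar> \<le> \<rho> \<longrightarrow>
      z2 (s, x) \<le> z2 (s0, 0) + (- a) * (s - s0) + (B + 1) * (s - s0)\<^sup>2 + (- p + \<epsilon>) * x)"
      if \<epsilon>: "0 < \<epsilon>" and d: "0 < d" for \<epsilon> d
    proof -
      obtain t x where x: "\<bar>t - t0\<bar> \<le> \<rho>" "0 \<le> x" "x < d"
        "z1 (t0, 0) + a * (t - t0) + (B + 1) * (t - t0)\<^sup>2 + p * x < z1 (t, x)"
        using nP d unfolding P_def eventual_slope_bound_def by (meson not_le)
      have "x \<noteq> 0"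
        using x bound1[of t 0] r zero_le_power2[of "t - t0"] unfolding distrib_right[of B 1] by force
      moreover have "0 \<le> \<epsilon> * x" using \<epsilon> x by simp
      then have "z2 (s, x) \<le> z2 (s0, 0) + (- a) * (s - s0) + (B + 1) * (s - s0)\<^sup>2 + (- p + \<epsilon>) * x"
        if "\<bar>s - s0\<bar> \<le> \<rho>" for s
        using split'[OF x(1) that x(2)] x(4) by (simp add: algebra_simps)
      ultimately show ?thesis using x by (intro exI[of _ x]) auto
    qed
    have "H (t0, 0) p \<le> - a - e" using slope1[of p, OF L0 _ _ _ above1 below1] by simp
    moreover have "- a \<le> H (s0, 0) p" using slope2[of "- p", OF L0 _ _ _ above2 below2] by simp
    ultimately show False using gap_H[of p] by simp
  qed
  have slice: "continuous_on UNIV (G X)"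
    if "continuous_on (data_domain T \<times> UNIV) (\<lambda>(X, p). G X p)" "X \<in> data_domain T"
    for G :: "real \<times> real \<Rightarrow> real \<Rightarrow> real" and X
  proof -
    have "continuous_on UNIV (\<lambda>p. (\<lambda>(X, p). G X p) (X, p))"
      by (rule continuous_on_compose2[OF that(1)]) (use that(2) in \<open>auto intro!: continuous_intros\<close>)
    then show ?thesis by simp
  qed
  note cont_slice = slice[OF cont(1)] slice[OF cont(2)]
  have "closed A" "closed B'" "closed D"
    unfolding A_def B'_def D_def using in_dom
    by (auto intro!: closed_Collect_le continuous_intros cont_slice)
  \<comment> \<open>If \<open>H\<close> and \<open>F\<close> are both small at \<open>t0\<close>,
    the two gaps push both strictly below \<open>- a\<close> at \<open>s0\<close>.\<close>
  moreover have "D \<inter> A \<inter> B' = {}"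
    using gap_H gap_F by (force simp: A_def B'_def D_def)
  moreover have "- L \<le> p" if "P p" for p
  proof (rule ccontr)
    assume "\<not> - L \<le> p"
    then have "P (- L)" using P_mono that by simp
    then show False
      using P_sub HL(2)[OF in_dom(1)] FL[OF in_dom(1)] B\<rho> by (fastforce simp: M_def)
  qed
  moreover have "L \<notin> A" using HL(1)[OF in_dom(1)] B\<rho> by (auto simp: A_def M_def)
  moreover have "p \<in> A \<union> B'" if "P p" for p using P_sub[OF that] by (auto simp: A_def B'_def)
  moreover have "p \<in> D" if "Q p" for p using Q_sup[OF that] by (simp add: D_def)
  ultimately show False
    using slope_dichotomy_absurd[of A B' D P L "- L" Q] P_mono Q_mono PL cover inf_P sup_Q by blast
qed

section \<open>Comparison\<close>

lemma quadratic_subsolution_mono: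
  assumes "quadratic_subsolution T S K' z" "\<And>X p. K X p \<le> K' X p"
  shows "quadratic_subsolution T S K z"
  unfolding quadratic_subsolution_def
proof (intro allI impI)
  fix a k m c t x d :: real
  assume *: "0 < t" "t < T" "x \<in> S" "0 < d"
    and max: "\<forall>t' x'. \<bar>t' - t\<bar> < d \<longrightarrow> \<bar>x' - x\<bar> < d \<longrightarrow> 0 \<le> x' \<longrightarrow>
          z (t', x') - (a * t' + k * t'\<^sup>2 + m * x' + c * x'\<^sup>2)
            \<le> z (t, x) - (a * t + k * t\<^sup>2 + m * x + c * x\<^sup>2)"
  have "a + 2 * k * t + K' (t, x) (m + 2 * c * x) \<le> 0"
    by (rule quadratic_subsolutionD[OF assms(1) *]) (use max in blast)
  then show "a + 2 * k * t + K (t, x) (m + 2 * c * x) \<le> 0"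
    using assms(2)[of "(t, x)" "m + 2 * c * x"] by linarith
qed

text \<open>The margin \<open>e\<close> has to absorb the time regularity error
  \<open>C * \<bar>t0 - s0\<bar> * (1 + \<bar>a\<bar>)\<close>. Since
  \<open>\<bar>t0 - s0\<bar> * \<bar>a\<bar>\<close> is twice the penalty at the maximizer, it tends
  to 0 along the subsequence. The hypothesis \<open>box\<close> supplies the compactness.\<close>

lemma strict_comparison:
  fixes H F :: "real \<times> real \<Rightarrow> real \<Rightarrow> real" and z1 z2 :: "real \<times> real \<Rightarrow> real"
  assumes usc: "upper_semicontinuous_on (solution_domain T) z1"
      "upper_semicontinuous_on (solution_domain T) z2"
    and sub1: "quadratic_subsolution T {0<..} (\<lambda>X p. H X p + e) z1"
      "quadratic_subsolution T {0} (\<lambda>X p. min (F X p) (H X p) + e) z1"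
    and sub2: "quadratic_subsolution T {0<..} (\<lambda>X p. - H X (- p)) z2"
      "quadratic_subsolution T {0} (\<lambda>X p. - max (F X (- p)) (H X (- p))) z2"
    and cont: "continuous_on (data_domain T \<times> UNIV) (\<lambda>(X, p). H X p)"
      "continuous_on (data_domain T \<times> UNIV) (\<lambda>(X, p). F X p)"
    and coercive: "\<And>M. \<exists>L. \<forall>X\<in>data_domain T. \<forall>p. H X p \<le> M \<longrightarrow> \<bar>p\<bar> \<le> L"
      "\<And>M. \<exists>L. \<forall>X\<in>data_domain T. \<forall>p. F X p \<le> M \<longrightarrow> - L \<le> p"
    and time_H: "\<And>s t x p. s \<in> {0..T} \<Longrightarrow> t \<in> {0..T} \<Longrightarrow> 0 \<le> x \<Longrightarrow>
      \<bar>H (s, x) p - H (t, x) p\<bar> \<le> C * \<bar>t - s\<bar> * (1 + max 0 (H (t, x) p))"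
    and time_F: "\<And>s t x p. s \<in> {0..T} \<Longrightarrow> t \<in> {0..T} \<Longrightarrow> 0 \<le> x \<Longrightarrow>
      \<bar>F (s, x) p - F (t, x) p\<bar> \<le> C * \<bar>t - s\<bar> * (1 + max 0 (max (F (t, x) p) (H (t, x) p)))"
    and C: "0 < C" and e: "0 < e"
    and bound: "\<And>X. X \<in> solution_domain T \<Longrightarrow> z1 X \<le> N"
    and initial: "\<And>x. 0 \<le> x \<Longrightarrow> z1 (0, x) + z2 (0, x) \<le> 0"
    and T': "T' < T"
    and box: "\<And>t s x. 0 \<le> t \<Longrightarrow> t < T \<Longrightarrow> 0 \<le> s \<Longrightarrow> s < T \<Longrightarrow> 0 \<le> x \<Longrightarrow>
      0 < z1 (t, x) + z2 (s, x) \<Longrightarrow> t \<le> T' \<and> s \<le> T' \<and> x \<le> R"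
    and X: "X \<in> solution_domain T"
  shows "z1 X + z2 X \<le> 0"
proof (rule ccontr)
  assume "\<not> ?thesis"
  then have pos: "0 < z1 X + z2 X" by simp
  define f where "f = (\<lambda>Y. z1 (fst Y, snd (snd Y)) + z2 (fst (snd Y), snd (snd Y)))"
  define g where "g = (\<lambda>Y::real \<times> real \<times> real. (fst Y - fst (snd Y))\<^sup>2)"
  define K where "K = {0..T'} \<times> {0..T'} \<times> {0..R}"
  define Y0 where "Y0 = (fst X, fst X, snd X)"
  have fY0: "0 < f Y0" using pos by (simp add: f_def Y0_def)
  have comp: "compact K" unfolding K_def by (intro compact_Times compact_Icc)
  have fusc: "upper_semicontinuous_on K f"
    unfolding f_def
    by (intro upper_semicontinuous_on_add upper_semicontinuous_on_compose[OF usc(1)]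
        upper_semicontinuous_on_compose[OF usc(2)] continuous_intros)
      (use T' in \<open>auto simp: K_def\<close>)
  have gcont: "continuous_on K g" unfolding g_def by (intro continuous_intros)
  have g_nonneg: "0 \<le> g Y" for Y by (simp add: g_def)
  have Y0: "Y0 \<in> K" "g Y0 = 0"
    using box[of "fst X" "fst X" "snd X"] X pos by (auto simp: K_def Y0_def g_def)
  have "\<exists>Z\<in>K. \<forall>Y\<in>K. f Y - real n * g Y \<le> f Z - real n * g Z" for n
    using Y0(1) by (intro upper_semicontinuous_on_attains_sup comp
        upper_semicontinuous_on_diff_continuous fusc continuous_intros gcont) auto
  then obtain z where z: "\<And>n. z n \<in> K"
    "\<And>n Y. Y \<in> K \<Longrightarrow> f Y - real n * g Y \<le> f (z n) - real n * g (z n)" by metis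
  obtain r l where r: "(z \<circ> r) \<longlonglongrightarrow> l" "l \<in> K" "g l = 0"
    "(\<lambda>n. real (r n) * g (z (r n))) \<longlonglongrightarrow> 0" "\<And>Y. Y \<in> K \<Longrightarrow> g Y = 0 \<Longrightarrow> f Y \<le> f l"
    by (rule penalized_maximizers_converge[OF comp fusc gcont g_nonneg Y0 z], assumption) (rule that)
  obtain tl xl where l: "l = (tl, tl, xl)" using r(3) by (cases l) (auto simp: g_def)
  \<comment> \<open>At time 0 the sum is nonpositive by \<open>initial\<close>, whereas its value at
    \<open>l\<close> is at least that at \<open>Y0\<close>.\<close>
  have "tl \<noteq> 0"
    using r(5)[OF Y0] fY0 initial[of xl] r(2) by (auto simp: f_def l K_def)
  then have tl: "0 < tl" using r(2) by (auto simp: l K_def)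
  define tn sn where "tn = (\<lambda>n. fst (z (r n)))" and "sn = (\<lambda>n. fst (snd (z (r n))))"
  have lim: "(\<lambda>n. z (r n)) \<longlonglongrightarrow> (tl, tl, xl)" using r(1) by (simp add: l comp_def)
  have tnl: "tn \<longlonglongrightarrow> tl" and snl: "sn \<longlonglongrightarrow> tl"
    using tendsto_fst[OF lim] tendsto_fst[OF tendsto_snd[OF lim]] by (simp_all add: tn_def sn_def)
  have "(\<lambda>n. C * \<bar>tn n - sn n\<bar> + 2 * C * (real (r n) * g (z (r n)))) \<longlonglongrightarrow> C * \<bar>tl - tl\<bar> + 2 * C * 0"
    by (intro tendsto_intros tnl snl r(4))
  then have "\<forall>\<^sub>F n in sequentially. C * \<bar>tn n - sn n\<bar> + 2 * C * (real (r n) * g (z (r n))) < e"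
    using e by (intro order_tendstoD(2)) auto
  then have "\<forall>\<^sub>F n in sequentially. C * \<bar>tn n - sn n\<bar> + 2 * C * (real (r n) * g (z (r n))) < e
      \<and> 0 < tn n \<and> 0 < sn n"
    using order_tendstoD(1)[OF tnl tl] order_tendstoD(1)[OF snl tl] by eventually_elim simp
  then obtain n where n: "C * \<bar>tn n - sn n\<bar> + 2 * C * (real (r n) * g (z (r n))) < e"
      "0 < tn n" "0 < sn n"
    using eventually_happens'[OF sequentially_bot] by blast
  define j where "j = real (r n)"
  obtain t0 s0 x0 where zr: "z (r n) = (t0, s0, x0)" by (metis surj_pair)
  have t0: "0 < t0" "t0 < T" and s0: "0 < s0" "s0 < T" and x0: "0 \<le> x0" and j: "0 \<le> j"
    using n z(1)[of "r n"] T' by (auto simp: tn_def sn_def zr K_def j_def)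
  \<comment> \<open>Maximality extends from \<open>K\<close> to all admissible points: a positive
    sum occurs only in \<open>K\<close>, and the penalised maximum is positive.\<close>
  have max: "z1 (t, x) + z2 (s, x) - j * (t - s)\<^sup>2 \<le> z1 (t0, x0) + z2 (s0, x0) - j * (t0 - s0)\<^sup>2"
    if "0 \<le> t" "t < T" "0 \<le> s" "s < T" "0 \<le> x" for t s x
  proof (cases "0 < z1 (t, x) + z2 (s, x)")
    case True
    then have "(t, s, x) \<in> K" using box[OF that True] that by (auto simp: K_def)
    from z(2)[OF this, of "r n"] show ?thesis by (simp add: zr f_def g_def j_def)
  next
    case False
    moreover have "0 \<le> j * (t - s)\<^sup>2" using j by simp
    moreover have "0 < f (z (r n)) - j * g (z (r n))"
      using z(2)[OF Y0(1), of "r n"] fY0 Y0(2) by (simp add: j_def)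
    ultimately show ?thesis by (simp add: zr f_def g_def)
  qed
  define a where "a = 2 * j * (t0 - s0)"
  have small: "C * \<bar>t0 - s0\<bar> * (1 + \<bar>a\<bar>) < e"
  proof -
    have "\<bar>a\<bar> = 2 * j * \<bar>t0 - s0\<bar>" using j by (simp add: a_def abs_mult)
    then have "C * \<bar>t0 - s0\<bar> * (1 + \<bar>a\<bar>) = C * \<bar>t0 - s0\<bar> + 2 * C * (j * \<bar>t0 - s0\<bar>\<^sup>2)"
      by (simp add: power2_eq_square distrib_left)
    then show ?thesis using n(1) by (simp add: tn_def sn_def zr g_def j_def)
  qed
  \<comment> \<open>A value \<open>h\<close> below \<open>- a - e\<close> satisfies
    \<open>max 0 h \<le> \<bar>a\<bar>\<close>, so the growth of the operators in \<open>p\<close>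
    does not enter the error.\<close>
  have growth: "C * \<bar>t0 - s0\<bar> * (1 + max 0 h) < e" if "h \<le> - a - e" for h
  proof -
    have "C * \<bar>t0 - s0\<bar> * (1 + max 0 h) \<le> C * \<bar>t0 - s0\<bar> * (1 + \<bar>a\<bar>)"
      using that e C by (intro mult_left_mono) auto
    then show ?thesis using small by linarith
  qed
  have in_T: "s0 \<in> {0..T}" "t0 \<in> {0..T}" using t0 s0 by auto
  have gap_H: "H (s0, x0) p < - a" if "H (t0, x0) p \<le> - a - e" for p
    using time_H[OF in_T x0, of p] growth[OF that] that by linarith
  have gap_F: "F (s0, x0) p < - a" if "H (t0, x0) p \<le> - a - e" "F (t0, x0) p \<le> - a - e" for p
    using time_F[OF in_T x0, of p] growth[of "max (F (t0, x0) p) (H (t0, x0) p)"] that by linarith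
  show False
  proof (cases "x0 = 0")
    case True
    show False
      by (rule boundary_maximum_absurd[OF usc sub1 sub2 cont coercive bound t0 s0 j
            max[unfolded True] a_def gap_H[unfolded True] gap_F[unfolded True]])
  next
    case False
    then have x0: "0 < x0" using x0 by simp
    note cont1 = continuous_on_case_prod_add_const[OF cont(1), of e]
    note cont2 = continuous_on_case_prod_reflect[OF cont(1)]
    have coercive1: "\<exists>L. \<forall>X\<in>data_domain T. \<forall>p. H X p + e \<le> M \<longrightarrow> \<bar>p\<bar> \<le> L" for M
      using coercive(1)[of "M - e"] by (simp add: le_diff_eq)
    obtain p where "2 * j * (t0 - s0) + (H (t0, x0) p + e) \<le> 0"
      "- (2 * j * (t0 - s0)) + - H (s0, x0) (- (- p)) \<le> 0"
      by (rule interior_doubling[OF usc sub1(1) sub2(1) cont1 cont2 coercive1 t0 s0 x0 j max],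
          assumption+)
    then show False using gap_H[of p] by (simp add: a_def)
  qed
qed

section \<open>Sign reversal of the supersolution, coercivity and choice of penalties\<close>

lemma lower_semicontinuous_on_imp_upper_uminus:
  assumes "lower_semicontinuous_on S f"
  shows "upper_semicontinuous_on S (\<lambda>x. - f x)"
  unfolding upper_semicontinuous_on_def
proof (intro ballI allI impI)
  fix x c assume "x \<in> S" "- f x < c"
  then have "\<forall>\<^sub>F y in at x within S. - c < f y"
    using assms unfolding lower_semicontinuous_on_def by simp
  then show "\<forall>\<^sub>F y in at x within S. - f y < c"
    by eventually_elim simp
qed

lemma C1_with_partials_uminus:
  assumes "C1_with_partials S \<phi> \<phi>t \<phi>x"
  shows "C1_with_partials S (\<lambda>X. - \<phi> X) (\<lambda>X. - \<phi>t X) (\<lambda>X. - \<phi>x X)"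
  unfolding C1_with_partials_def
proof (intro conjI ballI)
  show "continuous_on S (\<lambda>X. - \<phi>t X)" "continuous_on S (\<lambda>X. - \<phi>x X)"
    using assms unfolding C1_with_partials_def by (auto intro: continuous_on_minus)
  fix X assume "X \<in> S"
  then have "(\<phi> has_derivative (\<lambda>h. \<phi>t X * fst h + \<phi>x X * snd h)) (at X within S)"
    using assms unfolding C1_with_partials_def by blast
  from has_derivative_minus[OF this]
  show "((\<lambda>X. - \<phi> X) has_derivative (\<lambda>h. - \<phi>t X * fst h + - \<phi>x X * snd h)) (at X within S)"
    by (simp add: algebra_simps)
qed

lemma viscosity_supersolution_uminus_test:
  assumes "viscosity_supersolution T H F v" "C1_with_partials (test_domain T) \<phi> \<phi>t \<phi>x"
    and X: "X \<in> test_domain T" and max: "local_max_within (test_domain T) (\<lambda>Y. - v Y - \<phi> Y) X"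
  shows "0 < snd X \<Longrightarrow> \<phi>t X + - H X (- \<phi>x X) \<le> 0"
    and "snd X = 0 \<Longrightarrow> \<phi>t X + - max (F X (- \<phi>x X)) (H X (- \<phi>x X)) \<le> 0"
proof -
  have "local_min_within (test_domain T) (\<lambda>Y. v Y - - \<phi> Y) X"
    using max unfolding local_max_within_def local_min_within_def
    by (rule eventually_mono) simp
  then have "(0 < snd X \<longrightarrow> - \<phi>t X + H X (- \<phi>x X) \<ge> 0) \<and>
      (snd X = 0 \<longrightarrow> - \<phi>t X + max (F X (- \<phi>x X)) (H X (- \<phi>x X)) \<ge> 0)"
    using assms(1) C1_with_partials_uminus[OF assms(2)] X
    unfolding viscosity_supersolution_def by blast
  then show "0 < snd X \<Longrightarrow> \<phi>t X + - H X (- \<phi>x X) \<le> 0"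
    "snd X = 0 \<Longrightarrow> \<phi>t X + - max (F X (- \<phi>x X)) (H X (- \<phi>x X)) \<le> 0" by simp_all
qed

lemma hamiltonian_cond_coercive:
  assumes "hamiltonian_cond T C H"
  shows "\<exists>L. \<forall>X\<in>data_domain T. \<forall>p. H X p \<le> M \<longrightarrow> \<bar>p\<bar> \<le> L"
proof -
  \<comment> \<open>The shift to \<open>M + 1\<close> makes the lower bound incompatible with
    \<open>H X p \<le> M\<close>.\<close>
  have "\<forall>\<^sub>F p in at_infinity. \<forall>X\<in>data_domain T. M + 1 \<le> H X p"
    using assms unfolding hamiltonian_cond_def by blast
  then obtain b where b: "\<And>p X. b \<le> norm p \<Longrightarrow> X \<in> data_domain T \<Longrightarrow> M + 1 \<le> H X p"
    unfolding eventually_at_infinity by blast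
  have "\<bar>p\<bar> \<le> b" if "X \<in> data_domain T" "H X p \<le> M" for X p
    using b[of p X] that by (force simp: not_le[symmetric])
  then show ?thesis by blast
qed

lemma boundary_cond_coercive:
  assumes "boundary_cond T C H F"
  shows "\<exists>L. \<forall>X\<in>data_domain T. \<forall>p. F X p \<le> M \<longrightarrow> - L \<le> p"
proof -
  have "\<forall>\<^sub>F p in at_bot. \<forall>X\<in>data_domain T. M + 1 \<le> F X p"
    using assms unfolding boundary_cond_def by blast
  then obtain b where b: "\<And>p X. p \<le> b \<Longrightarrow> X \<in> data_domain T \<Longrightarrow> M + 1 \<le> F X p"
    unfolding eventually_at_bot_linorder by blast
  have "- (- b) \<le> p" if "X \<in> data_domain T" "F X p \<le> M" for X p
    using b[of p X] that by force
  then show ?thesis by blast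
qed

lemma comparison_principle:
  fixes H F :: "real \<times> real \<Rightarrow> real \<Rightarrow> real" and u v :: "real \<times> real \<Rightarrow> real"
  assumes T: "0 < T" and C: "0 < C" and ham: "hamiltonian_cond T C H" and bdc: "boundary_cond T C H F"
    and u_bdd: "bounded (u ` solution_domain T)" and u: "viscosity_subsolution T H F u"
    and v_bdd: "bounded (v ` solution_domain T)" and v: "viscosity_supersolution T H F v"
    and initial: "\<And>x. 0 \<le> x \<Longrightarrow> u (0, x) \<le> v (0, x)"
    and X: "X \<in> solution_domain T"
  shows "u X \<le> v X"
proof (rule ccontr)
  assume "\<not> u X \<le> v X"
  obtain tX xX where X_eq: "X = (tX, xX)" by (cases X)
  have tX: "0 \<le> tX" "tX < T" and xX: "0 \<le> xX" using X by (auto simp: X_eq)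
  define m where "m = u X - v X"
  have m: "0 < m" using \<open>\<not> u X \<le> v X\<close> by (simp add: m_def)
  \<comment> \<open>At the chosen point each function loses \<open>m / 8\<close> through the time
    penalty and at most \<open>m / 8\<close> through the linear one, so at least
    \<open>m / 2\<close> of the excess survives. The other bound on \<open>\<alpha>\<close> spends
    at most half of the gain \<open>\<eta> / T\<^sup>2\<close>, which leaves \<open>e\<close>
    positive.\<close>
  define \<eta> where "\<eta> = m * (T - tX) / 8"
  define \<alpha> where "\<alpha> = min (\<eta> / (2 * T\<^sup>2 * C)) (m / (8 * (xX + 1)))"
  define e where "e = \<eta> / T\<^sup>2 - C * \<alpha>"
  have \<eta>: "0 < \<eta>" using m tX by (simp add: \<eta>_def)
  have \<alpha>: "0 < \<alpha>" using \<eta> m C xX T by (simp add: \<alpha>_def)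
  have half: "r / 2 < r" if "0 < r" for r :: real using that by simp
  have rate: "0 < \<eta> / T\<^sup>2" using \<eta> T by simp
  have "C * \<alpha> \<le> C * (\<eta> / (2 * T\<^sup>2 * C))" using C by (intro mult_left_mono) (auto simp: \<alpha>_def)
  also have "\<dots> = \<eta> / T\<^sup>2 / 2" using C by simp
  also have "\<dots> < \<eta> / T\<^sup>2" by (rule half[OF rate])
  finally have e: "0 < e" by (simp add: e_def)
  define z1 where "z1 = (\<lambda>X. u X - \<eta> / (T - fst X) - \<alpha> * snd X)"
  define z2 where "z2 = (\<lambda>X. - v X - \<eta> / (T - fst X) - \<alpha> * snd X)"
  have H_lip: "\<bar>H X (p + q) - H X p\<bar> \<le> C * \<bar>q\<bar>" if "X \<in> data_domain T" for X p q
  proof -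
    have "\<forall>X\<in>data_domain T. \<forall>p q. \<bar>H X p - H X q\<bar> \<le> C * \<bar>p - q\<bar>"
      using ham unfolding hamiltonian_cond_def by blast
    from bspec[OF this that, rule_format, of "p + q" p] show ?thesis by simp
  qed
  have F_lip: "\<bar>F X (p + q) - F X p\<bar> \<le> C * \<bar>q\<bar>" if "X \<in> data_domain T" for X p q
  proof -
    have "\<forall>X\<in>data_domain T. \<forall>p q. \<bar>F X p - F X q\<bar> \<le> C * \<bar>p - q\<bar>"
      using bdc unfolding boundary_cond_def by blast
    from bspec[OF this that, rule_format, of "p + q" p] show ?thesis by simp
  qed
  have lip: "\<bar>H X (p + \<alpha>) - H X p\<bar> \<le> C * \<alpha>" "\<bar>F X (p + \<alpha>) - F X p\<bar> \<le> C * \<alpha>"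
    "\<bar>H X (- (p + \<alpha>)) - H X (- p)\<bar> \<le> C * \<alpha>" "\<bar>F X (- (p + \<alpha>)) - F X (- p)\<bar> \<le> C * \<alpha>"
    if "X \<in> data_domain T" for X p
    using H_lip[OF that, of p \<alpha>] F_lip[OF that, of p \<alpha>] H_lip[OF that, of "- p" "- \<alpha>"]
      F_lip[OF that, of "- p" "- \<alpha>"] \<alpha> by simp_all
  have usub: "(0 < snd Y \<longrightarrow> \<phi>t Y + H Y (\<phi>x Y) \<le> 0) \<and>
      (snd Y = 0 \<longrightarrow> \<phi>t Y + min (F Y (\<phi>x Y)) (H Y (\<phi>x Y)) \<le> 0)"
    if "C1_with_partials (test_domain T) \<phi> \<phi>t \<phi>x" "Y \<in> test_domain T"
      "local_max_within (test_domain T) (\<lambda>Y. u Y - \<phi> Y) Y" for \<phi> \<phi>t \<phi>x Y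
    using u that unfolding viscosity_subsolution_def by blast
  have \<eta>0: "0 \<le> \<eta>" and S: "{0<..} \<subseteq> {0::real..}" "{0} \<subseteq> {0::real..}" using \<eta> by auto
  have sub1: "quadratic_subsolution T {0<..} (\<lambda>X p. H X p + e) z1"
    unfolding z1_def e_def
    by (rule perturbed_quadratic_subsolution[OF T \<eta>0 S(1)]) (use usub lip in auto)
  have sub1': "quadratic_subsolution T {0} (\<lambda>X p. min (F X p) (H X p) + e) z1"
    unfolding z1_def e_def
  proof (rule perturbed_quadratic_subsolution[OF T \<eta>0 S(2)])
    show "\<bar>min (F X (p + \<alpha>)) (H X (p + \<alpha>)) - min (F X p) (H X p)\<bar> \<le> C * \<alpha>"
      if "X \<in> data_domain T" for X p
      using lip(1,2)[OF that, of p] by linarith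
  qed (use usub in auto)
  have "quadratic_subsolution T {0<..} (\<lambda>X p. - H X (- p) + e) z2"
    unfolding z2_def e_def
  proof (rule perturbed_quadratic_subsolution[OF T \<eta>0 S(1)])
    show "\<bar>- H X (- (p + \<alpha>)) - - H X (- p)\<bar> \<le> C * \<alpha>" if "X \<in> data_domain T" for X p
      using lip(3)[OF that, of p] by linarith
  qed (use viscosity_supersolution_uminus_test(1)[OF v] in auto)
  \<comment> \<open>The strict margin is retained for \<open>z1\<close> only.\<close>
  then have sub2: "quadratic_subsolution T {0<..} (\<lambda>X p. - H X (- p)) z2"
    by (rule quadratic_subsolution_mono) (use e in simp)
  have "quadratic_subsolution T {0} (\<lambda>X p. - max (F X (- p)) (H X (- p)) + e) z2"
    unfolding z2_def e_def
  proof (rule perturbed_quadratic_subsolution[OF T \<eta>0 S(2)])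
    show "\<bar>- max (F X (- (p + \<alpha>))) (H X (- (p + \<alpha>))) - - max (F X (- p)) (H X (- p))\<bar> \<le> C * \<alpha>"
      if "X \<in> data_domain T" for X p
      using lip(3,4)[OF that, of p] by linarith
  qed (use viscosity_supersolution_uminus_test(2)[OF v] in auto)
  then have sub2': "quadratic_subsolution T {0} (\<lambda>X p. - max (F X (- p)) (H X (- p))) z2"
    by (rule quadratic_subsolution_mono) (use e in simp)
  have penalty: "continuous_on (solution_domain T) (\<lambda>X. \<eta> / (T - fst X))"
    "continuous_on (solution_domain T) (\<lambda>X. \<alpha> * snd X)"
    by (auto intro!: continuous_intros)
  have usc: "upper_semicontinuous_on (solution_domain T) z1"
    "upper_semicontinuous_on (solution_domain T) z2"
    unfolding z1_def z2_def
    using u v lower_semicontinuous_on_imp_upper_uminus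
    by (auto intro!: upper_semicontinuous_on_diff_continuous penalty
        simp: viscosity_subsolution_def viscosity_supersolution_def)
  obtain Nu where Nu: "\<And>X. X \<in> solution_domain T \<Longrightarrow> \<bar>u X\<bar> \<le> Nu"
    using u_bdd by (auto simp: bounded_iff)
  obtain Nv where Nv: "\<And>X. X \<in> solution_domain T \<Longrightarrow> \<bar>v X\<bar> \<le> Nv"
    using v_bdd by (auto simp: bounded_iff)
  define N where "N = \<bar>Nu\<bar> + \<bar>Nv\<bar> + 1"
  have N: "0 < N" by (simp add: N_def)
  have pen_nonneg: "0 \<le> \<eta> / (T - t)" "0 \<le> \<alpha> * x" if "t < T" "0 \<le> x" for t x
    using that \<eta> \<alpha> by auto
  \<comment> \<open>Where the sum is positive, each penalty is at most the bound \<open>N\<close> on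
    \<open>u - v\<close>: \<open>\<eta> / (T - t) \<le> N\<close> yields the time limit
    \<open>T - \<eta> / N\<close>, and \<open>\<alpha> * x \<le> N\<close> the radius
    \<open>N / \<alpha>\<close>.\<close>
  have "z1 X + z2 X \<le> 0"
  proof (rule strict_comparison[OF usc sub1 sub1' sub2 sub2' _ _ hamiltonian_cond_coercive[OF ham]
        boundary_cond_coercive[OF bdc] _ _ C e _ _ _ _ X, where N = N and T' = "T - \<eta> / N" and R = "N / \<alpha>"])
    show "z1 X \<le> N" if "X \<in> solution_domain T" for X
      using Nu[OF that] pen_nonneg[of "fst X" "snd X"] that by (auto simp: z1_def N_def)
    show "z1 (0, x) + z2 (0, x) \<le> 0" if "0 \<le> x" for x
      using initial[OF that] that pen_nonneg[of 0 x] T by (simp add: z1_def z2_def)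
    show "T - \<eta> / N < T" using \<eta> N by simp
    show "t \<le> T - \<eta> / N \<and> s \<le> T - \<eta> / N \<and> x \<le> N / \<alpha>"
      if t: "0 \<le> t" "t < T" "0 \<le> s" "s < T" and x: "0 \<le> x" and "0 < z1 (t, x) + z2 (s, x)" for t s x
    proof -
      have "u (t, x) - v (s, x) \<le> N"
        using Nu[of "(t, x)"] Nv[of "(s, x)"] t x by (auto simp: N_def)
      then have "\<eta> / (T - t) + \<eta> / (T - s) + 2 * (\<alpha> * x) \<le> N" using that by (simp add: z1_def z2_def)
      then have "\<eta> / (T - t) \<le> N" "\<eta> / (T - s) \<le> N" "\<alpha> * x \<le> N"
        using pen_nonneg[of t x] pen_nonneg[of s x] t x by linarith+
      then show ?thesis using t N \<alpha> by (simp add: field_simps)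
    qed
  qed (use ham bdc in \<open>auto simp: hamiltonian_cond_def boundary_cond_def\<close>)
  moreover have "\<eta> / (T - tX) = m / 8"
    using tX by (subst divide_eq_eq) (simp add: \<eta>_def)
  moreover have "\<alpha> * xX \<le> m / 8"
  proof -
    have "\<alpha> \<le> m / (8 * (xX + 1))" by (simp add: \<alpha>_def)
    then have "\<alpha> * (8 * (xX + 1)) \<le> m" using xX by (subst (asm) pos_le_divide_eq) auto
    then show ?thesis using xX \<alpha> by (simp add: algebra_simps)
  qed
  ultimately show False using m by (simp add: z1_def z2_def X_eq m_def)
qed

theorem theorem1p1:
  fixes T :: real
    and H F :: "real \<times> real \<Rightarrow> real \<Rightarrow> real"
    and u\<^sub>0 :: "real \<Rightarrow> real"
    and u v :: "real \<times> real \<Rightarrow> real"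
  assumes "T > 0"
    and "\<exists>C>0. hamiltonian_cond T C H \<and> boundary_cond T C H F"
    and "bounded (u\<^sub>0 ` {0..})"
    and "\<exists>L. L-lipschitz_on {0..} u\<^sub>0"
    and "bounded (u ` solution_domain T)"
    and "viscosity_subsolution T H F u"
    and "bounded (v ` solution_domain T)"
    and "viscosity_supersolution T H F v"
    and "\<forall>x\<ge>0. u (0, x) \<le> u\<^sub>0 x \<and> u\<^sub>0 x \<le> v (0, x)"
  shows "\<forall>X\<in>solution_domain T. u X \<le> v X"
proof
  fix X assume X: "X \<in> solution_domain T"
  obtain C where C: "0 < C" "hamiltonian_cond T C H" "boundary_cond T C H F" using assms(2) by blast
  have initial: "u (0, x) \<le> v (0, x)" if "0 \<le> x" for x using assms(9) that order_trans by blast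
  show "u X \<le> v X"
    by (rule comparison_principle[OF assms(1) C assms(5-8) initial X])
qed

end
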